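(* Let $p$ be an odd prime, $n\ge2$, and let $D_n=\mathbb F_p[y_1,\dots,y_n]^{GL(n,\mathbb F_p)}$ and $\mathbb F_p(1,n-1)=\mathbb F_p[y_1,\dots,y_n]^{P(1,n-1)}$. Let $B=\{h_1^{(p-1)m} : 0\le m\le p^{n-1}+\dots+p\}$, where $h_1=y_1$, which is a free $D_n$-module basis of $\mathbb F_p(1,n-1)$. Let $\xi:\mathbb F_p(1,n-1)\to D_n$ be the natural epimorphism with respect to $B$, and let $\tau^*:\mathbb F_p(1,n-1)\to D_n$ be the transfer map. Then $\xi=\tau^*$.
   Context: $GL(n,\mathbb F_p)$ acts on $\mathbb F_p[y_1,\dots,y_n]$ by algebra automorphisms determined by $(a_{ij})\,y_k=\sum_i a_{ik}y_i$. The parabolic subgroup is $P(k,n-k)=\left\{\begin{pmatrix}A&C\\0&B\end{pmatrix}: A\in GL(k,\mathbb F_p),\ B\in GL(n-k,\mathbb F_p)\right\}$. The natural epimorphism $\xi$ with respect to a free $D_n$-basis $B$ containing $1$ is the $D_n$-linear map sending $f=\sum_{b\in B}c_b\,b$ (with $c_b\in D_n$) to $c_1$, the coefficient of the basis element $1$. The transfer is $\tau^*(f)=\sum_{g} g f$, where $g$ runs over a set of left coset representatives of $P(1,n-1)$ in $GL(n,\mathbb F_p)$. *)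

theory Defs
  imports
    "HOL-Library.Poly_Mapping"
    "HOL-Algebra.Left_Coset"
    "Jordan_Normal_Form.Matrix"
    "Berlekamp_Zassenhaus.Finite_Field"
begin

text \<open>
  Polynomials with coefficients in \<open>'a\<close> and variables indexed by \<open>nat\<close>: finitely supported maps from
  monomials (finitely supported exponent vectors) to coefficients, with the convolution product
  as ring multiplication. Matrix indices start at 0, so the variables do as well: the
  variable usually written \<open>y\<^sub>k\<^sub>+\<^sub>1\<close> is \<open>var k\<close>.
\<close>

type_synonym 'a mpoly = "(nat \<Rightarrow>\<^sub>0 nat) \<Rightarrow>\<^sub>0 'a"

definition var :: "nat \<Rightarrow> 'a::comm_ring_1 mpoly" where
  "var i = Poly_Mapping.single (Poly_Mapping.single i 1) 1"

definition const :: "'a::comm_ring_1 \<Rightarrow> 'a mpoly" where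
  "const c = Poly_Mapping.single 0 c"

definition polys :: "nat \<Rightarrow> 'a::comm_ring_1 mpoly set" where
  "polys n = {f. \<forall>m \<in> Poly_Mapping.keys f. Poly_Mapping.keys m \<subseteq> {..<n}}"

definition subst :: "(nat \<Rightarrow> 'a mpoly) \<Rightarrow> 'a::comm_ring_1 mpoly \<Rightarrow> 'a mpoly" where
  "subst \<sigma> f = (\<Sum>m \<in> Poly_Mapping.keys f.
     const (Poly_Mapping.lookup f m) *
     (\<Prod>i \<in> Poly_Mapping.keys m. \<sigma> i ^ Poly_Mapping.lookup m i))"

definition act :: "'a::comm_ring_1 mat \<Rightarrow> 'a mpoly \<Rightarrow> 'a mpoly" where
  "act A = subst (\<lambda>k. \<Sum>i<dim_row A. const (A $$ (i, k)) * var i)"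

lemma act_var: "act A (var k) = (\<Sum>i<dim_row A. const (A $$ (i, k)) * var i)"
  by (simp add: act_def subst_def var_def const_def)

definition GL :: "nat \<Rightarrow> 'a::comm_ring_1 mat monoid" where
  "GL n = units_of (ring_mat TYPE('a) n ())"

lemma carrier_GL:
  "carrier (GL n) = {A \<in> carrier_mat n n. invertible_mat (A :: 'a::comm_ring_1 mat)}"
proof (intro equalityI subsetI)
  fix A :: "'a mat"
  assume "A \<in> carrier (GL n)"
  then show "A \<in> {A \<in> carrier_mat n n. invertible_mat A}"
    by (auto simp: GL_def units_of_def Units_def ring_mat_def invertible_mat_def inverts_mat_def)
next
  fix A :: "'a mat"
  assume "A \<in> {A \<in> carrier_mat n n. invertible_mat A}"
  then obtain B where A: "A \<in> carrier_mat n n" and AB: "A * B = 1\<^sub>m n"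
    and BA: "B * A = 1\<^sub>m (dim_row B)"
    by (auto simp: invertible_mat_def inverts_mat_def)
  have "dim_col B = n" using arg_cong[OF AB, of dim_col] by simp
  moreover have "dim_row B = n" using arg_cong[OF BA, of dim_col] A by simp
  ultimately have "B \<in> carrier_mat n n" "B * A = 1\<^sub>m n" using BA by auto
  with A AB show "A \<in> carrier (GL n)"
    by (auto simp: GL_def units_of_def Units_def ring_mat_def)
qed

definition parabolic :: "nat \<Rightarrow> nat \<Rightarrow> 'a::comm_ring_1 mat set" where
  "parabolic k l = {four_block_mat A C (0\<^sub>m l k) B | A B C.
     A \<in> carrier (GL k) \<and> B \<in> carrier (GL l) \<and> C \<in> carrier_mat k l}"

definition invariants :: "nat \<Rightarrow> 'a::comm_ring_1 mat set \<Rightarrow> 'a mpoly set" where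
  "invariants n H = {f \<in> polys n. \<forall>g\<in>H. act g f = f}"

abbreviation dickson_algebra :: "nat \<Rightarrow> 'a::comm_ring_1 mpoly set" where
  "dickson_algebra n \<equiv> invariants n (carrier (GL n))"

text \<open>
  Coordinate families vanish outside \<open>B\<close>, so that they are unique as functions
  whenever the expansion in \<open>B\<close> is unique.
\<close>

definition coordinates :: "'r::comm_ring_1 set \<Rightarrow> 'r set \<Rightarrow> 'r \<Rightarrow> ('r \<Rightarrow> 'r) \<Rightarrow> bool" where
  "coordinates D B f c \<longleftrightarrow>
     (\<forall>b. c b \<in> D) \<and> finite {b. c b \<noteq> 0} \<and> {b. c b \<noteq> 0} \<subseteq> B \<and>
     f = (\<Sum>b | c b \<noteq> 0. c b * b)"

definition free_basis :: "'r::comm_ring_1 set \<Rightarrow> 'r set \<Rightarrow> 'r set \<Rightarrow> bool" where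
  "free_basis D B M \<longleftrightarrow> B \<subseteq> M \<and> (\<forall>f\<in>M. \<exists>!c. coordinates D B f c)"

definition natural_epi :: "'r::comm_ring_1 set \<Rightarrow> 'r set \<Rightarrow> 'r \<Rightarrow> 'r" where
  "natural_epi D B f = (THE c. coordinates D B f c) 1"

definition left_transversal :: "'g set \<Rightarrow> ('g, 'm) monoid_scheme \<Rightarrow> 'g set \<Rightarrow> bool" where
  "left_transversal R G H \<longleftrightarrow>
     R \<subseteq> carrier G \<and> (\<forall>X \<in> lcosets\<^bsub>G\<^esub> H. \<exists>!g. g \<in> R \<and> g \<in> X)"

definition transfer :: "'a::comm_ring_1 mat set \<Rightarrow> 'a mpoly \<Rightarrow> 'a mpoly" where
  "transfer R f = (\<Sum>g\<in>R. act g f)"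

end

theory Submission
  imports Defs "Jordan_Normal_Form.Determinant"
begin

text \<open>
  Write \<open>y\<close> for the first variable and \<open>h = y\<^sup>p\<^sup>-\<^sup>1\<close>. The cosets of the parabolic subgroup
  correspond to the lines of linear forms, and the conjugates of \<open>h\<close> are the pairwise distinct
  powers \<open>r = v\<^sup>p\<^sup>-\<^sup>1\<close>, one for each line. Expansions in powers of \<open>h\<close> below the number of
  conjugates are therefore unique, by counting roots.

  For existence let \<open>G\<close> be the product of \<open>Z - r\<close> over the conjugates \<open>r \<noteq> h\<close>, with coefficients
  \<open>G\<^sub>m\<close>, and let \<open>c\<^sub>0\<close> be the product of \<open>- r\<close> over all conjugates. Translation by \<open>y\<close> of the linear
  forms that are not multiples of \<open>y\<close> shows \<open>h G(h) = h G(0) = - c\<^sub>0\<close>. Summing over conjugates (Lagrange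
  interpolation) gives \<open>- c\<^sub>0 f = \<Sum>\<^sub>m \<tau>(f h G\<^sub>m) h\<^sup>m\<close>. A transfer \<open>\<tau>(u h)\<close> is divisible by \<open>y\<close>, hence,
  being invariant, by \<open>c\<^sub>0\<close>, so that the coefficients \<open>- \<tau>(f h G\<^sub>m) / c\<^sub>0\<close> lie in the Dickson algebra. The
  one for \<open>m = 0\<close> is \<open>- \<tau>(- c\<^sub>0 f) / c\<^sub>0 = \<tau>(f)\<close>.
\<close>

section \<open>Substitution in polynomials\<close>

definition mono_val :: "(nat \<Rightarrow> 'a mpoly) \<Rightarrow> (nat \<Rightarrow>\<^sub>0 nat) \<Rightarrow> 'a::comm_ring_1 mpoly" where
  "mono_val \<sigma> m = (\<Prod>i\<in>Poly_Mapping.keys m. \<sigma> i ^ Poly_Mapping.lookup m i)"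

lemma mono_val_superset:
  assumes "finite K" "Poly_Mapping.keys m \<subseteq> K"
  shows "mono_val \<sigma> m = (\<Prod>i\<in>K. \<sigma> i ^ Poly_Mapping.lookup m i)"
  unfolding mono_val_def using assms
  by (intro prod.mono_neutral_left) (auto simp: in_keys_iff)

lemma mono_val_0 [simp]: "mono_val \<sigma> 0 = 1"
  by (simp add: mono_val_def)

lemma mono_val_single [simp]: "mono_val \<sigma> (Poly_Mapping.single i (Suc 0)) = \<sigma> i"
  by (simp add: mono_val_def)

lemma mono_val_add: "mono_val \<sigma> (m + k) = mono_val \<sigma> m * mono_val \<sigma> k"
proof -
  let ?K = "Poly_Mapping.keys m \<union> Poly_Mapping.keys k"
  have "mono_val \<sigma> l = (\<Prod>i\<in>?K. \<sigma> i ^ Poly_Mapping.lookup l i)" if "l \<in> {m, k, m + k}" for l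
    using that keys_add[of m k] by (intro mono_val_superset) auto
  then show ?thesis by (simp add: lookup_add power_add prod.distrib)
qed

lemma const_0 [simp]: "const 0 = 0" and const_1 [simp]: "const 1 = 1"
  by (simp_all add: const_def)

lemma const_add: "const (a + b) = const a + const b"
  and const_diff: "const (a - b) = const a - const b"
  and const_uminus: "const (- a) = - const a"
  and const_mult: "const (a * b) = const a * const b"
  by (simp_all add: const_def single_add single_diff single_uminus mult_single)

lemma const_power: "const (a ^ k) = const a ^ k"
  by (induction k) (simp_all add: const_mult)

lemma const_sum: "const (sum f I) = (\<Sum>i\<in>I. const (f i))"
  by (induction I rule: infinite_finite_induct) (simp_all add: const_add)

lemma const_eq_0_iff [simp]: "const a = 0 \<longleftrightarrow> a = 0"
  by (metis const_0 const_def lookup_single_eq lookup_zero)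

lemma const_inj: "const a = const b \<longleftrightarrow> a = b"
  by (metis const_diff const_eq_0_iff right_minus_eq)

lemma var_neq_0 [simp]: "var j \<noteq> (0 :: 'a::comm_ring_1 mpoly)"
  by (metis lookup_single_eq lookup_zero var_def zero_neq_one)

text \<open>A polynomial is the finite sum of its terms, so an additive property need only be
  checked on single terms; zero is the term with coefficient 0.\<close>

lemma mpoly_induct [case_names single add]:
  fixes f :: "'a::comm_ring_1 mpoly"
  assumes "\<And>m c. P (Poly_Mapping.single m c)" "\<And>f g. P f \<Longrightarrow> P g \<Longrightarrow> P (f + g)"
  shows "P f"
proof -
  have "P (\<Sum>m\<in>K. Poly_Mapping.single m (Poly_Mapping.lookup f m))" if "finite K" for K
    using that
  proof (induction K)
    case empty
    show ?case using assms(1)[of 0 0] by simp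
  qed (simp add: assms)
  moreover have "f = (\<Sum>m\<in>Poly_Mapping.keys f. Poly_Mapping.single m (Poly_Mapping.lookup f m))"
    by (intro poly_mapping_eqI)
      (auto simp: lookup_sum lookup_single when_def in_keys_iff sum.delta' cong: if_cong)
  ultimately show ?thesis by (metis finite_keys)
qed

lemma single_eq_const_mult: "Poly_Mapping.single m c = const c * mono_val var m"
proof -
  have *: "var i ^ k = (Poly_Mapping.single (Poly_Mapping.single i k) 1 :: 'a mpoly)" for i k
    by (induction k) (simp_all add: var_def mult_single single_add[symmetric])
  have "(\<Prod>i\<in>K. Poly_Mapping.single (Poly_Mapping.single i (Poly_Mapping.lookup m i)) 1) =
      (Poly_Mapping.single (\<Sum>i\<in>K. Poly_Mapping.single i (Poly_Mapping.lookup m i)) 1 :: 'a mpoly)" for K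
    by (induction K rule: infinite_finite_induct) (simp_all add: mult_single)
  moreover have "(\<Sum>i\<in>Poly_Mapping.keys m. Poly_Mapping.single i (Poly_Mapping.lookup m i)) = m"
    by (intro poly_mapping_eqI)
      (auto simp: lookup_sum lookup_single when_def in_keys_iff sum.delta' cong: if_cong)
  ultimately show ?thesis
    by (simp add: mono_val_def * const_def mult_single)
qed

lemma subst_superset:
  assumes "finite K" "Poly_Mapping.keys f \<subseteq> K"
  shows "subst \<sigma> f = (\<Sum>m\<in>K. const (Poly_Mapping.lookup f m) * mono_val \<sigma> m)"
  unfolding subst_def mono_val_def using assms
  by (intro sum.mono_neutral_left) (auto simp: in_keys_iff)

lemma subst_single: "subst \<sigma> (Poly_Mapping.single m c) = const c * mono_val \<sigma> m"
  by (subst subst_superset[of "{m}"]) auto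

lemma subst_add: "subst \<sigma> (f + g) = subst \<sigma> f + subst \<sigma> g"
proof -
  let ?K = "Poly_Mapping.keys f \<union> Poly_Mapping.keys g"
  have "subst \<sigma> l = (\<Sum>m\<in>?K. const (Poly_Mapping.lookup l m) * mono_val \<sigma> m)" if "l \<in> {f, g, f + g}" for l
    using that keys_add[of f g] by (intro subst_superset) auto
  then show ?thesis by (simp add: lookup_add const_add algebra_simps sum.distrib)
qed

lemma subst_mult: "subst \<sigma> (f * g) = subst \<sigma> f * subst \<sigma> g"
proof (induction f rule: mpoly_induct)
  case (single m c)
  show ?case
    by (induction g rule: mpoly_induct)
      (simp_all add: subst_single subst_add mult_single mono_val_add const_mult algebra_simps)
qed (simp_all add: subst_add algebra_simps)

lemma subst_const [simp]: "subst \<sigma> (const c) = const c"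
  by (simp add: const_def subst_single)

lemma subst_var [simp]: "subst \<sigma> (var i) = \<sigma> i"
  by (simp add: var_def subst_single)

lemma subst_0 [simp]: "subst \<sigma> 0 = 0" and subst_1 [simp]: "subst \<sigma> 1 = 1"
  using subst_const[of \<sigma> 0] subst_const[of \<sigma> 1] by simp_all

lemma subst_uminus: "subst \<sigma> (- f) = - subst \<sigma> f"
  using subst_add[of \<sigma> f "- f"] by (simp add: eq_neg_iff_add_eq_0 add.commute)

lemma subst_diff: "subst \<sigma> (f - g) = subst \<sigma> f - subst \<sigma> g"
  using subst_add[of \<sigma> f "- g"] by (simp add: subst_uminus)

lemma subst_power: "subst \<sigma> (f ^ k) = subst \<sigma> f ^ k"
  by (induction k) (simp_all add: subst_mult)

lemma subst_sum: "subst \<sigma> (sum f I) = (\<Sum>i\<in>I. subst \<sigma> (f i))"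
  by (induction I rule: infinite_finite_induct) (simp_all add: subst_add)

lemma subst_prod: "subst \<sigma> (prod f I) = (\<Prod>i\<in>I. subst \<sigma> (f i))"
  by (induction I rule: infinite_finite_induct) (simp_all add: subst_mult)

lemmas subst_hom = subst_add subst_diff subst_uminus subst_mult subst_power subst_sum subst_prod

lemma subst_mono_val: "subst \<sigma> (mono_val \<tau> m) = mono_val (\<lambda>i. subst \<sigma> (\<tau> i)) m"
  by (simp add: mono_val_def subst_hom)

lemma subst_subst: "subst \<sigma> (subst \<tau> f) = subst (\<lambda>i. subst \<sigma> (\<tau> i)) f"
  by (induction f rule: mpoly_induct) (simp_all add: subst_single subst_hom subst_mono_val)

lemma subst_id: "subst var f = f"
  by (induction f rule: mpoly_induct)
    (simp_all add: subst_single subst_hom single_eq_const_mult[symmetric])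

lemma subst_cong:
  assumes "f \<in> polys n" "\<And>i. i < n \<Longrightarrow> \<sigma> i = \<tau> i"
  shows "subst \<sigma> f = subst \<tau> f"
  using assms unfolding subst_def polys_def by (intro sum.cong prod.cong arg_cong2[where f = "(*)"]) force+

lemma dvd_diff_mult:
  fixes d :: "'a::comm_ring_1"
  assumes "d dvd a - b" "d dvd a' - b'" shows "d dvd a * a' - b * b'"
proof -
  have "a * a' - b * b' = (a - b) * a' + b * (a' - b')" by (simp add: algebra_simps)
  then show ?thesis using assms by simp
qed

text \<open>Substitution respects congruence modulo \<open>d\<close>. Taking \<open>var\<close> as
  one of the two substitutions, it shows that a map fixing all variables modulo \<open>d\<close>
  fixes all polynomials modulo \<open>d\<close>.\<close>

lemma subst_congruent:
  assumes "f \<in> polys n" "\<And>i. i < n \<Longrightarrow> d dvd \<sigma> i - \<tau> i"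
  shows "d dvd subst \<sigma> f - subst \<tau> f"
proof -
  have pow: "d dvd a ^ k - b ^ k" if "d dvd a - b" for a b :: "'a mpoly" and k
    by (induction k) (use that in \<open>auto intro: dvd_diff_mult\<close>)
  have "d dvd (\<Prod>i\<in>K. \<sigma> i ^ k i) - (\<Prod>i\<in>K. \<tau> i ^ k i)" if "K \<subseteq> {..<n}" for K k
    using finite_subset[OF that] that
    by (induction K rule: finite_induct) (auto intro: dvd_diff_mult pow assms)
  then show ?thesis
    using assms(1) unfolding subst_def polys_def
    by (auto simp: sum_subtractf[symmetric] right_diff_distrib[symmetric] intro!: dvd_sum dvd_mult)
qed

section \<open>Closure properties of the ring of polynomials in the first n variables\<close>

lemma polys_0 [simp]: "0 \<in> polys n" and polys_const [simp]: "const c \<in> polys n"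
  by (auto simp: polys_def const_def)

lemma polys_1 [simp]: "1 \<in> polys n"
  using polys_const[of 1] by simp

lemma polys_var: "i < n \<Longrightarrow> var i \<in> polys n"
  by (auto simp: polys_def var_def)

lemma polys_add: "f \<in> polys n \<Longrightarrow> g \<in> polys n \<Longrightarrow> f + g \<in> polys n"
  using keys_add[of f g] by (auto simp: polys_def)

lemma polys_mult: "f \<in> polys n \<Longrightarrow> g \<in> polys n \<Longrightarrow> f * g \<in> polys n"
  using keys_mult[of f g] unfolding polys_def by (blast dest!: subsetD[OF keys_add])

lemma polys_uminus: "f \<in> polys n \<Longrightarrow> - f \<in> polys n"
  using polys_mult[OF polys_const[of "-1"], of f] by (simp add: const_uminus)

lemma polys_diff: "f \<in> polys n \<Longrightarrow> g \<in> polys n \<Longrightarrow> f - g \<in> polys n"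
  using polys_add[OF _ polys_uminus, of f n g] by simp

lemma polys_sum: "(\<And>i. i \<in> I \<Longrightarrow> f i \<in> polys n) \<Longrightarrow> sum f I \<in> polys n"
  by (induction I rule: infinite_finite_induct) (auto intro: polys_add)

lemma polys_prod: "(\<And>i. i \<in> I \<Longrightarrow> f i \<in> polys n) \<Longrightarrow> prod f I \<in> polys n"
  by (induction I rule: infinite_finite_induct) (auto intro: polys_mult)

lemma polys_power: "f \<in> polys n \<Longrightarrow> f ^ k \<in> polys n"
  by (induction k) (auto intro: polys_mult)

lemmas polys_intros = polys_0 polys_1 polys_const polys_var polys_add polys_mult polys_uminus
  polys_diff polys_sum polys_prod polys_power

lemma subst_polys:
  assumes "f \<in> polys n" "\<And>i. i < n \<Longrightarrow> \<sigma> i \<in> polys k"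
  shows "subst \<sigma> f \<in> polys k"
  using assms unfolding subst_def
  by (intro polys_intros) (auto simp: polys_def[of n])

lemma ex_polys: "\<exists>N. f \<in> polys N"
proof -
  have "finite (\<Union>m\<in>Poly_Mapping.keys f. Poly_Mapping.keys m)" by simp
  then obtain N where "(\<Union>m\<in>Poly_Mapping.keys f. Poly_Mapping.keys m) \<subseteq> {..<N}"
    using finite_nat_iff_bounded by blast
  then show ?thesis by (intro exI[of _ N]) (auto simp: polys_def)
qed

text \<open>Setting the variables of index at least n to zero fixes \<open>f\<close> and
  \<open>d\<close>; cancelling \<open>d\<close> in the image of \<open>f = d * q\<close> shows that
  \<open>q\<close> is fixed as well.\<close>

lemma polys_dvdD:
  fixes f :: "'a::idom mpoly"
  assumes "f \<in> polys n" "d \<in> polys n" "d \<noteq> 0" "f = d * q"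
  shows "q \<in> polys n"
proof -
  define \<pi> where "\<pi> = (\<lambda>i. if i < n then var i else (0 :: 'a mpoly))"
  have fix_pi: "subst \<pi> g = g" if "g \<in> polys n" for g
    using subst_cong[OF that, of \<pi> var] by (simp add: \<pi>_def subst_id)
  have "d * q = subst \<pi> (d * q)" using fix_pi assms by metis
  also have "\<dots> = d * subst \<pi> q" using assms by (simp add: subst_mult fix_pi)
  finally have q: "q = subst \<pi> q" using assms(3) by simp
  obtain N where "q \<in> polys N" using ex_polys by blast
  then have "subst \<pi> q \<in> polys n" by (rule subst_polys) (auto simp: \<pi>_def intro: polys_var)
  with q show ?thesis by simp
qed

section \<open>Linear forms and the general linear group\<close>

definition linear_form :: "nat \<Rightarrow> (nat \<Rightarrow> 'a) \<Rightarrow> 'a::comm_ring_1 mpoly" where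
  "linear_form n c = (\<Sum>i<n. const (c i) * var i)"

abbreviation linear_forms :: "nat \<Rightarrow> 'a::comm_ring_1 mpoly set" where
  "linear_forms n \<equiv> range (linear_form n)"

lemma linear_form_polys [simp]: "linear_form n c \<in> polys n"
  by (auto simp: linear_form_def intro!: polys_intros)

lemma lookup_linear_form:
  assumes "j < n"
  shows "Poly_Mapping.lookup (linear_form n c) (Poly_Mapping.single j 1) = c j"
proof -
  have inj: "Poly_Mapping.single i (Suc 0) = Poly_Mapping.single j (Suc 0) \<longleftrightarrow> i = j" for i
    by (metis lookup_single_eq lookup_single_not_eq nat.distinct(1))
  have "Poly_Mapping.lookup (const a * var i) (Poly_Mapping.single j 1) = (if i = j then a else 0)" for i and a :: 'a
    by (auto simp: const_def var_def mult_single lookup_single when_def inj)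
  then show ?thesis using assms by (simp add: linear_form_def lookup_sum)
qed

lemma linear_form_cong: "(\<And>i. i < n \<Longrightarrow> c i = d i) \<Longrightarrow> linear_form n c = linear_form n d"
  by (auto simp: linear_form_def intro: sum.cong)

lemma linear_form_eq_iff: "linear_form n c = linear_form n d \<longleftrightarrow> (\<forall>i<n. c i = d i)"
  using linear_form_cong lookup_linear_form by metis

lemma linear_form_0: "linear_form n (\<lambda>_. 0) = 0"
  by (simp add: linear_form_def)

lemma linear_form_eq_0_iff: "linear_form n c = 0 \<longleftrightarrow> (\<forall>i<n. c i = 0)"
  using linear_form_eq_iff[of n c "\<lambda>_. 0"] by (simp add: linear_form_0)

lemma linear_form_add: "linear_form n c + linear_form n d = linear_form n (\<lambda>i. c i + d i)"
  by (simp add: linear_form_def const_add algebra_simps sum.distrib)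

lemma linear_form_scale: "const a * linear_form n c = linear_form n (\<lambda>i. a * c i)"
  by (simp add: linear_form_def const_mult sum_distrib_left mult.assoc)

lemma var_eq_linear_form: "j < n \<Longrightarrow> var j = linear_form n (\<lambda>i. if i = j then 1 else 0)"
  by (simp add: linear_form_def if_distrib[of const] if_distrib[of "\<lambda>x. x * _"] cong: if_cong)

lemma subst_linear_form: "subst \<sigma> (linear_form n c) = (\<Sum>i<n. const (c i) * \<sigma> i)"
  by (simp add: linear_form_def subst_hom)

lemma finite_linear_forms [simp]: "finite (linear_forms n :: 'a::{comm_ring_1, finite} mpoly set)"
  and card_linear_forms: "card (linear_forms n :: 'a mpoly set) = CARD('a) ^ n"
proof -
  let ?E = "{..<n} \<rightarrow>\<^sub>E (UNIV :: 'a set)"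
  have "linear_form n c \<in> linear_form n ` ?E" for c :: "nat \<Rightarrow> 'a"
    by (intro image_eqI[of _ _ "restrict c {..<n}"]) (auto intro: linear_form_cong)
  then have eq: "linear_forms n = linear_form n ` ?E" by auto
  have "inj_on (linear_form n) ?E"
    by (intro inj_onI PiE_ext) (auto simp: linear_form_eq_iff)
  then show "card (linear_forms n :: 'a mpoly set) = CARD('a) ^ n"
    unfolding eq by (simp add: card_image card_PiE)
  show "finite (linear_forms n :: 'a mpoly set)"
    unfolding eq by (intro finite_imageI finite_PiE) auto
qed

section \<open>The action of matrices on polynomials\<close>

lemmas act_hom = subst_hom[where \<sigma> = "\<lambda>k. \<Sum>i<dim_row A. const (A $$ (i, k)) * var i" for A, folded act_def]

lemma act_const [simp]: "act A (const c) = const c"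
  and act_0 [simp]: "act A 0 = 0" and act_1 [simp]: "act A 1 = 1"
  by (simp_all add: act_def)

lemma act_var_linear_form: "A \<in> carrier_mat n m \<Longrightarrow> act A (var k) = linear_form n (\<lambda>i. A $$ (i, k))"
  by (auto simp: act_var linear_form_def)

lemma act_polys: "A \<in> carrier_mat n m \<Longrightarrow> f \<in> polys k \<Longrightarrow> act A f \<in> polys n"
  unfolding act_def by (rule subst_polys) (auto intro!: polys_intros)

text \<open>Column k of a matrix holds the coefficients of the image of variable k, so composing
  substitutions multiplies matrices in the order of a left action.\<close>

lemma act_mult:
  assumes "A \<in> carrier_mat n n" "B \<in> carrier_mat n n" "f \<in> polys n"
  shows "act (A * B) f = act A (act B f)"
proof -
  have "(\<Sum>i<n. const ((A * B) $$ (i, k)) * var i) =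
      act A (\<Sum>j<n. const (B $$ (j, k)) * var j)" if "k < n" for k
  proof -
    have "act A (\<Sum>j<n. const (B $$ (j, k)) * var j) =
        (\<Sum>j<n. \<Sum>i<n. const (A $$ (i, j) * B $$ (j, k)) * var i)"
      using assms by (simp add: act_hom act_var const_mult sum_distrib_left algebra_simps)
    also have "\<dots> = (\<Sum>i<n. \<Sum>j<n. const (A $$ (i, j) * B $$ (j, k)) * var i)"
      by (rule sum.swap)
    also have "\<dots> = (\<Sum>i<n. const ((A * B) $$ (i, k)) * var i)"
      using assms that
      by (intro sum.cong refl)
        (simp add: scalar_prod_def const_sum sum_distrib_right atLeast0LessThan)
    finally show ?thesis by simp
  qed
  then have "subst (\<lambda>k. \<Sum>i<n. const ((A * B) $$ (i, k)) * var i) f =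
      subst (\<lambda>k. act A (\<Sum>j<n. const (B $$ (j, k)) * var j)) f"
    by (intro subst_cong[OF assms(3)])
  then show ?thesis
    using assms by (simp add: act_def subst_subst)
qed

lemma act_one:
  assumes "f \<in> polys n" shows "act (1\<^sub>m n) f = f"
proof -
  have "act (1\<^sub>m n) f = subst var f"
    unfolding act_def
  proof (rule subst_cong[OF assms])
    fix k assume "k < n"
    then have "(\<Sum>i<n. const (1\<^sub>m n $$ (i, k)) * var i) = linear_form n (\<lambda>i. if i = k then 1 else 0)"
      unfolding linear_form_def by (intro sum.cong) auto
    also have "\<dots> = var k" by (rule var_eq_linear_form[symmetric]) fact
    finally show "(\<Sum>i<dim_row (1\<^sub>m n). const (1\<^sub>m n $$ (i, k)) * var i) = (var k :: 'a mpoly)" by simp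
  qed
  then show ?thesis by (simp add: subst_id)
qed

section \<open>The general linear group, its parabolic subgroup and special elements\<close>

lemma group_GL: "group (GL n)"
  unfolding GL_def by (rule monoid.units_group[OF ring.is_monoid[OF ring_mat]])

lemma GL_simps [simp]: "x \<otimes>\<^bsub>GL n\<^esub> y = x * y" "\<one>\<^bsub>GL n\<^esub> = 1\<^sub>m n"
  by (simp_all add: GL_def units_of_def ring_mat_simps)

lemma GL_iff: "A \<in> carrier (GL n) \<longleftrightarrow> A \<in> carrier_mat n n \<and> det A \<noteq> (0 :: 'a::field)"
proof -
  have "A \<in> Units (ring_mat TYPE('a) n ()) \<Longrightarrow> A \<in> carrier_mat n n"
    by (auto simp: Units_def ring_mat_simps)
  then show ?thesis
    unfolding GL_def units_of_carrier
    using unit_imp_det_non_zero[of A n "()"] det_non_zero_imp_unit[of A n "()"] by auto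
qed

lemma GL_carrier_mat [dest]: "A \<in> carrier (GL n) \<Longrightarrow> A \<in> carrier_mat n (n :: nat)"
  by (simp add: carrier_GL)

text \<open>Block shape restricts only the first column below the diagonal. The determinant is the
  product of those of the diagonal blocks, so \<open>g\<close> is invertible exactly when both
  blocks are.\<close>

lemma parabolic_iff:
  fixes g :: "'a::field mat"
  assumes "0 < n"
  shows "g \<in> parabolic 1 (n - 1) \<longleftrightarrow> g \<in> carrier (GL n) \<and> (\<forall>i. 0 < i \<longrightarrow> i < n \<longrightarrow> g $$ (i, 0) = 0)"
proof (intro iffI conjI allI impI)
  assume "g \<in> parabolic 1 (n - 1)"
  then obtain A B C where *: "g = four_block_mat A C (0\<^sub>m (n - 1) 1) B" "A \<in> carrier (GL 1)"
    "B \<in> carrier (GL (n - 1))" "C \<in> carrier_mat 1 (n - 1)"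
    by (auto simp: parabolic_def)
  have "four_block_mat A C (0\<^sub>m (n - 1) 1) B \<in> carrier_mat (1 + (n - 1)) (1 + (n - 1))"
    using * by (intro four_block_carrier_mat) auto
  moreover have "det g = det A * det B"
    using * by (auto intro!: det_four_block_mat_lower_left_zero)
  ultimately show "g \<in> carrier (GL n)" using * assms by (auto simp: GL_iff)
  show "g $$ (i, 0) = 0" if "0 < i" "i < n" for i
    using * that by (auto dest!: GL_carrier_mat)
next
  assume *: "g \<in> carrier (GL n) \<and> (\<forall>i. 0 < i \<longrightarrow> i < n \<longrightarrow> g $$ (i, 0) = 0)"
  obtain A C Z B where s: "split_block g 1 1 = (A, C, Z, B)" by (metis surj_pair)
  have "dim_row g = 1 + (n - 1)" "dim_col g = 1 + (n - 1)" using * assms by auto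
  note sb = split_block[OF s this]
  have Z: "Z = 0\<^sub>m (n - 1) 1"
    using s * by (auto simp: split_block_def Let_def intro!: eq_matI)
  have "det g = det A * det B"
    using sb by (simp add: det_four_block_mat_lower_left_zero[OF sb(1,2) Z sb(4)])
  then have "A \<in> carrier (GL 1)" "B \<in> carrier (GL (n - 1))"
    using * sb by (auto simp: GL_iff)
  then show "g \<in> parabolic 1 (n - 1)"
    using sb Z unfolding parabolic_def by blast
qed

text \<open>The matrix sends variable \<open>j\<close> to itself plus \<open>a / c j\<close> times y
  and fixes the other variables; the coefficient \<open>c j\<close> of the form turns this into
  \<open>a\<close> times y. All variables are fixed modulo y, hence so are all polynomials.\<close>

lemma transvection_exists:
  fixes c :: "nat \<Rightarrow> 'a::field"
  assumes "0 < j" "j < n" "c j \<noteq> 0"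
  obtains g where "g \<in> carrier (GL n)" "act g (linear_form n c) = linear_form n c + const a * var 0"
    "\<And>f. f \<in> polys n \<Longrightarrow> var 0 dvd act g f - f"
proof
  let ?g = "addrow_mat n (a / c j) 0 j :: 'a mat"
  have g: "?g \<in> carrier_mat n n" by simp
  then show "?g \<in> carrier (GL n)" using assms by (simp add: GL_iff det_addrow_mat)
  have v: "act ?g (var k) = var k + (if k = j then const (a / c j) * var 0 else 0)" if "k < n" for k
  proof -
    have "act ?g (var k) = linear_form n
        (\<lambda>i. (if i = k then 1 else 0) + (if k = j then a / c j else 0) * (if i = 0 then 1 else 0))"
      unfolding act_var_linear_form[OF g] using that assms
      by (intro linear_form_cong) (auto simp: addrow_mat_def)
    also have "\<dots> = var k + const (if k = j then a / c j else 0) * var 0"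
      using that assms by (simp add: linear_form_add[symmetric] linear_form_scale[symmetric] var_eq_linear_form[of _ n])
    finally show ?thesis by simp
  qed
  have "act ?g (linear_form n c) =
      (\<Sum>k<n. const (c k) * var k + (if k = j then const (c k) * (const (a / c j) * var 0) else 0))"
    by (simp add: linear_form_def act_hom v distrib_left if_distrib[of "\<lambda>x. _ * x"] cong: if_cong)
  also have "\<dots> = linear_form n c + const (c j) * (const (a / c j) * var 0)"
    using assms by (simp add: sum.distrib linear_form_def)
  also have "const (c j) * (const (a / c j) * var 0) = const a * var 0"
    using assms by (simp add: mult.assoc[symmetric] const_mult[symmetric])
  finally show "act ?g (linear_form n c) = linear_form n c + const a * var 0" .
  show "var 0 dvd act ?g f - f" if "f \<in> polys n" for f
  proof -
    have "var 0 dvd subst (\<lambda>k. act ?g (var k)) f - subst var f"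
      using that by (rule subst_congruent) (simp add: v)
    then show ?thesis by (simp add: act_def subst_id)
  qed
qed

text \<open>The diagonal matrix scaling only the first variable. Modulo y it is the identity, yet it
  multiplies y by \<open>a\<close>, which makes the exact power of y in an invariant
  visible.\<close>

lemma torus_exists:
  fixes a :: "'a::field"
  assumes "0 < n" "a \<noteq> 0"
  obtains g where "g \<in> carrier (GL n)" "act g (var 0) = const a * var 0"
    "\<And>f. f \<in> polys n \<Longrightarrow> var 0 dvd act g f - f"
proof
  let ?g = "multrow_mat n 0 a :: 'a mat"
  have g: "?g \<in> carrier_mat n n" by simp
  then show "?g \<in> carrier (GL n)" using assms by (simp add: GL_iff det_multrow_mat)
  have v: "act ?g (var k) = const (if k = 0 then a else 1) * var k" if "k < n" for k
  proof -
    have "act ?g (var k) = linear_form n (\<lambda>i. (if k = 0 then a else 1) * (if i = k then 1 else 0))"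
      unfolding act_var_linear_form[OF g] using that assms
      by (intro linear_form_cong) (auto simp: multrow_mat_def)
    then show ?thesis
      using that by (simp add: linear_form_scale[symmetric] var_eq_linear_form[symmetric])
  qed
  then show "act ?g (var 0) = const a * var 0" using assms by simp
  show "var 0 dvd act ?g f - f" if "f \<in> polys n" for f
  proof -
    have "var 0 dvd subst (\<lambda>k. act ?g (var k)) f - subst var f"
      using that by (rule subst_congruent) (simp add: v left_diff_distrib[symmetric])
    then show ?thesis by (simp add: act_def subst_id)
  qed
qed

lemma GL_inverse:
  assumes "g \<in> carrier (GL n)"
  obtains g' where "g' \<in> carrier (GL n)" "g * g' = 1\<^sub>m n" "g' * g = 1\<^sub>m n"
  using group.l_inv[OF group_GL assms] group.r_inv[OF group_GL assms] group.inv_closed[OF group_GL assms]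
  by auto

lemma GL_mult: "g \<in> carrier (GL n) \<Longrightarrow> k \<in> carrier (GL n) \<Longrightarrow> g * k \<in> carrier (GL n)"
  using monoid.m_closed[OF group.is_monoid[OF group_GL], of g n k] by simp

lemma act_GL_mult:
  "g \<in> carrier (GL n) \<Longrightarrow> k \<in> carrier (GL n) \<Longrightarrow> f \<in> polys n \<Longrightarrow> act (g * k) f = act g (act k f)"
  by (intro act_mult) auto

lemma inj_on_act:
  assumes "g \<in> carrier (GL n)" shows "inj_on (act g) (polys n)"
proof -
  obtain g' where g': "g' \<in> carrier (GL n)" "g' * g = 1\<^sub>m n" using GL_inverse[OF assms] .
  have "act g' (act g f) = f" if "f \<in> polys n" for f
    using act_GL_mult[OF g'(1) assms that] that by (simp add: g' act_one)
  then show ?thesis by (rule inj_on_inverseI)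
qed

lemma act_linear_forms:
  assumes "g \<in> carrier_mat n n" "v \<in> linear_forms n" shows "act g v \<in> linear_forms n"
proof -
  obtain c where v: "v = linear_form n c" using assms by auto
  have "act g v = (\<Sum>i<n. linear_form n (\<lambda>k. c i * g $$ (k, i)))"
    using assms by (simp add: v linear_form_def[of n c] act_hom act_var_linear_form linear_form_scale)
  also have "\<dots> = linear_form n (\<lambda>k. \<Sum>i<n. c i * g $$ (k, i))"
    unfolding linear_form_def const_sum sum_distrib_right by (rule sum.swap)
  finally show ?thesis by simp
qed

text \<open>An injective self-map of the finite set of linear forms is bijective, and it fixes
  0.\<close>

lemma act_image_nonzero_linear_forms:
  assumes "g \<in> carrier (GL n)"
  shows "bij_betw (act g) (linear_forms n - {0}) (linear_forms n - {0 :: 'a::{field, finite} mpoly})"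
proof -
  have inj: "inj_on (act g) (linear_forms n)"
    by (rule inj_on_subset[OF inj_on_act[OF assms]]) auto
  have "act g ` linear_forms n \<subseteq> linear_forms n" using assms by (auto intro: act_linear_forms)
  then have "act g ` linear_forms n = linear_forms n"
    using inj by (intro endo_inj_surj) auto
  then have "bij_betw (act g) (linear_forms n) (linear_forms n)"
    using inj by (simp add: bij_betw_def)
  moreover have "bij_betw (act g) {0} {0}" by simp
  moreover have "(0 :: 'a mpoly) \<in> linear_forms n" by (metis linear_form_0 rangeI)
  ultimately show ?thesis by (auto intro: bij_betw_DiffI)
qed

text \<open>If the coefficient of y in \<open>v\<close> is nonzero, the coefficients of
  \<open>v\<close> can replace the first column of the identity matrix: the result is lower
  triangular with nonzero diagonal. Otherwise a transvection first adds y to \<open>v\<close>, and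
  its inverse is applied afterwards.\<close>

lemma GL_transitive:
  fixes v :: "'a::field mpoly"
  assumes "v \<in> linear_forms n" "v \<noteq> 0"
  obtains g where "g \<in> carrier (GL n)" "act g (var 0) = v"
proof -
  have n: "0 < n" using assms by (cases n) (auto simp: linear_form_def)
  have *: "\<exists>g\<in>carrier (GL n). act g (var 0) = linear_form n c" if "c 0 \<noteq> 0" for c :: "nat \<Rightarrow> 'a"
  proof
    let ?g = "mat n n (\<lambda>(i, j). if j = 0 then c i else if i = j then 1 else 0)"
    have g: "?g \<in> carrier_mat n n" by simp
    have "det ?g = prod_list (diag_mat ?g)"
      by (rule det_lower_triangular[of n]) auto
    also have "\<dots> \<noteq> 0" using that by (auto simp: prod_list_diag_prod)
    finally show "?g \<in> carrier (GL n)" by (simp add: GL_iff)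
    show "act ?g (var 0) = linear_form n c"
      unfolding act_var_linear_form[OF g] using n by (intro linear_form_cong) auto
  qed
  obtain c where c: "v = linear_form n c" using assms by auto
  then obtain j where j: "j < n" "c j \<noteq> 0" using assms by (auto simp: linear_form_eq_0_iff)
  show ?thesis
  proof (cases "c 0 = 0")
    case False
    then show ?thesis using *[of c] that c by auto
  next
    case True
    then have "0 < j" using j by (cases j) auto
    then obtain t where t: "t \<in> carrier (GL n)" "act t v = v + const 1 * var 0"
      using transvection_exists[of j n c 1] j c by metis
    have "act t v = linear_form n (\<lambda>i. c i + (if i = 0 then 1 else 0))"
      unfolding t(2) using n by (simp add: c linear_form_add[symmetric] var_eq_linear_form[of _ n])
    with True obtain g where g: "g \<in> carrier (GL n)" "act g (var 0) = act t v"
      using *[of "\<lambda>i. c i + (if i = 0 then 1 else 0)"] by auto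
    obtain s where s: "s \<in> carrier (GL n)" "s * t = 1\<^sub>m n" using GL_inverse[OF t(1)] .
    have "act (s * g) (var 0) = act s (act t v)"
      using act_GL_mult[OF s(1) g(1) polys_var[OF n]] g by simp
    also have "\<dots> = act (s * t) v" using act_GL_mult[OF s(1) t(1)] c by simp
    also have "\<dots> = v" using c by (simp add: s act_one)
    finally show ?thesis using that GL_mult[OF s(1) g(1)] by blast
  qed
qed

section \<open>Finite fields and lines of linear forms\<close>

text \<open>Translation by 1 permutes the field, so it preserves the sum of all elements although it
  adds 1 once for each of them.\<close>

lemma of_nat_card_finite_field: "of_nat CARD('a) = (0 :: 'a::finite_field)"
proof -
  have "(\<Sum>x\<in>UNIV. x) = (\<Sum>x\<in>UNIV. x + 1 :: 'a)"
    by (rule sum.reindex_bij_witness[of _ "\<lambda>x. x + 1" "\<lambda>x. x - 1"]) auto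
  then show ?thesis by (simp add: sum.distrib)
qed

lemma card_finite_field_gt_1: "1 < CARD('a::finite_field)"
proof -
  have "card {0, 1 :: 'a} \<le> CARD('a)" by (intro card_mono) auto
  then show ?thesis by simp
qed

lemma of_nat_card_minus_1: "of_nat (CARD('a) - 1) = (- 1 :: 'a::finite_field)"
  using card_finite_field_gt_1[where 'a = 'a] of_nat_card_finite_field[where 'a = 'a]
  by (simp add: of_nat_diff)

lemma of_nat_mpoly: "(of_nat k :: 'a::comm_ring_1 mpoly) = const (of_nat k)"
  by (induction k) (simp_all add: const_add)

lemma power_card_minus_1: "(a :: 'a::finite_field) \<noteq> 0 \<Longrightarrow> a ^ (CARD('a) - 1) = 1"
  using finite_field_power_card_eq_same[of a] card_finite_field_gt_1[where 'a = 'a]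
  by (cases "CARD('a)") auto

text \<open>The polynomial \<open>X^k - 1\<close> has at most \<open>k\<close> roots, fewer than
  there are nonzero field elements.\<close>

lemma exists_power_neq_1:
  assumes "0 < k" "k < CARD('a) - 1"
  obtains a :: "'a::finite_field" where "a \<noteq> 0" "a ^ k \<noteq> 1"
proof -
  let ?P = "Polynomial.monom (1 :: 'a) k - 1"
  have "degree ?P \<le> k" by (intro degree_diff_le) (auto simp: degree_monom_eq)
  moreover have "coeff ?P k = 1" using assms by simp
  ultimately have P: "degree ?P = k" "?P \<noteq> 0" using le_degree[of ?P k] by auto
  have "\<not> (UNIV - {0}) \<subseteq> {a. poly ?P a = 0}"
  proof
    assume "UNIV - {0} \<subseteq> {a. poly ?P a = 0}"
    then have "card (UNIV - {0 :: 'a}) \<le> card {a. poly ?P a = 0}"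
      by (intro card_mono poly_roots_finite P) auto
    also have "\<dots> \<le> k" using card_poly_roots_bound[OF P(2)] P by simp
    finally show False using assms by (simp add: card_Diff_singleton)
  qed
  then show ?thesis using that by (auto simp: poly_monom)
qed

text \<open>As polynomials in \<open>x\<close> both sides are monic of degree
  \<open>CARD('a) - 1\<close> and vanish at the distinct nonzero multiples of \<open>w\<close>,
  which are as many as the degree.\<close>

lemma prod_diff_scalar_multiples:
  fixes w :: "'a::finite_field mpoly"
  assumes "w \<noteq> 0"
  shows "(\<Prod>a\<in>UNIV - {0}. x - const a * w) = x ^ (CARD('a) - 1) - w ^ (CARD('a) - 1)"
proof -
  let ?q = "CARD('a)"
  define A where "A = (\<lambda>a. const a * w) ` (UNIV - {0})"
  define P where "P = Polynomial.monom 1 (?q - 1) - [:w ^ (?q - 1):]"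
  define Q where "Q = (\<Prod>z\<in>A. [:-z, 1:])"
  have q: "1 < ?q" by (rule card_finite_field_gt_1)
  have inj: "inj_on (\<lambda>a. const a * w) B" for B
    using assms by (auto simp: inj_on_def const_inj)
  then have card_A: "card A = ?q - 1"
    by (simp add: A_def card_image card_Diff_singleton)
  have "P = Q"
  proof (rule poly_eqI_degree_lead_coeff)
    show "card A \<ge> ?q - 1" by (simp add: card_A)
    show "degree P \<le> ?q - 1"
      unfolding P_def by (intro degree_diff_le) (auto simp: degree_monom_eq)
    have deg_Q: "degree Q = ?q - 1"
      unfolding Q_def by (subst degree_prod_eq_sum_degree) (auto simp: card_A)
    then show "degree Q \<le> ?q - 1" by simp
    have "lead_coeff Q = 1" unfolding Q_def by (simp add: lead_coeff_prod)
    then show "coeff P (?q - 1) = coeff Q (?q - 1)"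
      using q by (auto simp: deg_Q P_def coeff_pCons split: nat.split)
    fix z assume z: "z \<in> A"
    then obtain a where "z = const a * w" "a \<noteq> 0" by (auto simp: A_def)
    then have "poly P z = 0"
      using power_card_minus_1[of a]
      by (simp add: P_def poly_monom power_mult_distrib const_power[symmetric])
    moreover have "poly Q z = 0"
      using z by (auto simp: Q_def poly_prod A_def intro!: prod_zero bexI[of _ z])
    ultimately show "poly P z = poly Q z" by simp
  qed
  moreover have "poly Q x = (\<Prod>a\<in>UNIV - {0}. x - const a * w)"
    unfolding Q_def A_def poly_prod by (subst prod.reindex[OF inj]) simp
  ultimately have "poly P x = (\<Prod>a\<in>UNIV - {0}. x - const a * w)" by simp
  then show ?thesis by (simp add: P_def poly_monom)
qed

lemma eq_scalar_multiple_if_power_eq: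
  fixes w :: "'a::finite_field mpoly"
  assumes "v ^ (CARD('a) - 1) = w ^ (CARD('a) - 1)" "w \<noteq> 0"
  obtains a where "a \<noteq> 0" "v = const a * w"
proof -
  have "(\<Prod>a\<in>UNIV - {0}. v - const a * w) = 0"
    using prod_diff_scalar_multiples[OF assms(2), of v] assms(1) by simp
  then show ?thesis using that by (auto simp: prod_zero_iff)
qed

section \<open>Cosets of the parabolic subgroup as lines\<close>

text \<open>The first column of \<open>g\<close> lists the coefficients of the image of y, so the
  parabolic subgroup is the stabilizer of the line spanned by y.\<close>

lemma parabolic_iff_scalar:
  fixes g :: "'a::field mat"
  assumes "0 < n"
  shows "g \<in> parabolic 1 (n - 1) \<longleftrightarrow> g \<in> carrier (GL n) \<and> (\<exists>a. act g (var 0) = const a * var 0)"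
proof (cases "g \<in> carrier (GL n)")
  case True
  then have "act g (var 0) = const a * var 0 \<longleftrightarrow>
      (\<forall>i<n. g $$ (i, 0) = a * (if i = 0 then 1 else 0))" for a
    unfolding var_eq_linear_form[OF assms] linear_form_scale
    by (simp add: act_var_linear_form[of g n n] GL_carrier_mat linear_form_eq_iff flip: var_eq_linear_form[OF assms])
  moreover have "(\<forall>i. 0 < i \<longrightarrow> i < n \<longrightarrow> g $$ (i, 0) = 0) \<longleftrightarrow>
      (\<exists>a. \<forall>i<n. g $$ (i, 0) = a * (if i = 0 then 1 else 0))"
    by (auto intro!: exI[of _ "g $$ (0, 0)"])
  ultimately show ?thesis unfolding parabolic_iff[OF assms] by simp
qed (use parabolic_iff[OF assms, of g] in simp)

lemma act_var_0_neq_0: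
  fixes g :: "'a::field mat"
  assumes "g \<in> carrier (GL n)" "0 < n" shows "act g (var 0) \<noteq> 0"
proof
  have var: "(var 0 :: 'a mpoly) \<in> polys n" using assms(2) by (rule polys_var)
  assume "act g (var 0) = 0"
  then have "var 0 = (0 :: 'a mpoly)"
    using inj_onD[OF inj_on_act[OF assms(1)], of "var 0" 0] var by simp
  with var show False by simp
qed

text \<open>The quotient of \<open>g\<close> by \<open>k\<close> on the left stabilizes the line of
  y.\<close>

lemma GL_factor:
  fixes g k :: "'a::field mat"
  assumes "0 < n" "g \<in> carrier (GL n)" "k \<in> carrier (GL n)"
    and "act g (var 0) = const a * act k (var 0)"
  obtains q where "q \<in> parabolic 1 (n - 1)" "g = k * q"
proof -
  obtain k' where k': "k' \<in> carrier (GL n)" "k * k' = 1\<^sub>m n" "k' * k = 1\<^sub>m n"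
    using GL_inverse[OF assms(3)] .
  have var: "(var 0 :: 'a mpoly) \<in> polys n" using assms by (intro polys_var)
  have "act (k' * g) (var 0) = act k' (const a * act k (var 0))"
    using act_GL_mult[OF k'(1) assms(2) var] assms(4) by simp
  also have "\<dots> = const a * act (k' * k) (var 0)"
    using act_GL_mult[OF k'(1) assms(3) var] by (simp add: act_hom)
  also have "\<dots> = const a * var 0" using var by (simp add: k' act_one)
  finally have "k' * g \<in> parabolic 1 (n - 1)"
    using assms k' unfolding parabolic_iff_scalar[OF assms(1)] by (auto intro: GL_mult)
  moreover have "k * (k' * g) = k * k' * g"
    using assms k' by (intro assoc_mult_mat[symmetric]) auto
  ultimately show ?thesis using that[of "k' * g"] assms k' by auto
qed

text \<open>On an invariant of the parabolic subgroup a matrix acts only through the line to which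
  it moves y.\<close>

lemma act_eq_if_scalar:
  fixes u :: "'a::field mpoly"
  assumes "0 < n" "g \<in> carrier (GL n)" "k \<in> carrier (GL n)"
    and "act g (var 0) = const a * act k (var 0)" "u \<in> invariants n (parabolic 1 (n - 1))"
  shows "act g u = act k u"
proof -
  obtain q where q: "q \<in> parabolic 1 (n - 1)" "g = k * q" using GL_factor[OF assms(1-4)] .
  moreover have "q \<in> carrier (GL n)" using q parabolic_iff_scalar[OF assms(1)] by blast
  ultimately show ?thesis using assms by (auto simp: invariants_def act_GL_mult)
qed

lemma lcoset_iff:
  fixes g k :: "'a::field mat"
  assumes "0 < n" "g \<in> carrier (GL n)" "k \<in> carrier (GL n)"
  shows "g \<in> k <#\<^bsub>GL n\<^esub> parabolic 1 (n - 1) \<longleftrightarrow> (\<exists>a. act g (var 0) = const a * act k (var 0))"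
proof
  assume "g \<in> k <#\<^bsub>GL n\<^esub> parabolic 1 (n - 1)"
  then obtain q where q: "q \<in> parabolic 1 (n - 1)" "g = k * q" by (auto simp: l_coset_def)
  then obtain a where a: "q \<in> carrier (GL n)" "act q (var 0) = const a * var 0"
    using parabolic_iff_scalar[OF assms(1)] by blast
  have "act g (var 0) = act k (act q (var 0))"
    unfolding q(2) using act_GL_mult[OF assms(3) a(1) polys_var[OF assms(1)]] .
  then have "act g (var 0) = const a * act k (var 0)" by (simp add: a act_hom)
  then show "\<exists>a. act g (var 0) = const a * act k (var 0)" ..
next
  assume "\<exists>a. act g (var 0) = const a * act k (var 0)"
  then obtain a where "act g (var 0) = const a * act k (var 0)" ..
  from GL_factor[OF assms this] show "g \<in> k <#\<^bsub>GL n\<^esub> parabolic 1 (n - 1)"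
    by (auto simp: l_coset_def)
qed

lemma scalar_multiple_swap:
  fixes w :: "'a::field mpoly"
  assumes "a \<noteq> 0" "const a * v = const b * w" shows "v = const (b / a) * w"
proof -
  have "const (1 / a) * (const a * v) = const (1 / a) * (const b * w)" using assms by simp
  then show ?thesis using assms(1) by (simp add: mult.assoc[symmetric] const_mult[symmetric])
qed

text \<open>Orbits and stabilizers: the group is transitive on lines and the parabolic subgroup
  stabilizes one of them, so \<open>R\<close> picks one generator on each line, and the scalar runs
  through the remaining points of that line.\<close>

lemma bij_betw_transversal_lines:
  fixes R :: "'a::field mat set"
  assumes n: "0 < n" and R: "left_transversal R (GL n) (parabolic 1 (n - 1))"
  shows "bij_betw (\<lambda>(g, a). const a * act g (var 0)) (R \<times> (UNIV - {0})) (linear_forms n - {0})"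
proof -
  have RG: "g \<in> carrier (GL n)" if "g \<in> R" for g using R that by (auto simp: left_transversal_def)
  have ex1: "\<exists>!g. g \<in> R \<and> g \<in> k <#\<^bsub>GL n\<^esub> parabolic 1 (n - 1)" if "k \<in> carrier (GL n)" for k
  proof -
    have "k <#\<^bsub>GL n\<^esub> parabolic 1 (n - 1) \<in> lcosets\<^bsub>GL n\<^esub> parabolic 1 (n - 1)"
      using that by (auto simp: LCOSETS_def)
    then show ?thesis using R unfolding left_transversal_def by blast
  qed
  have "g = g' \<and> a = a'"
    if *: "g \<in> R" "g' \<in> R" "a \<noteq> 0" "const a * act g (var 0) = const a' * act g' (var 0)" for g g' a a'
  proof -
    have "act g (var 0) = const (a' / a) * act g' (var 0)"
      using * by (intro scalar_multiple_swap)
    then have "g \<in> g' <#\<^bsub>GL n\<^esub> parabolic 1 (n - 1)"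
      using lcoset_iff[OF n] RG * by blast
    moreover have "act g' (var 0) = const 1 * act g' (var 0)" by simp
    then have "g' \<in> g' <#\<^bsub>GL n\<^esub> parabolic 1 (n - 1)"
      using lcoset_iff[OF n] RG * by blast
    ultimately have "g = g'" using ex1[of g'] RG * by blast
    moreover have "a = a'"
      using *(4) act_var_0_neq_0[OF RG[OF *(2)] n] unfolding \<open>g = g'\<close> by (simp add: const_inj)
    ultimately show ?thesis ..
  qed
  note uniq = this
  have inj: "inj_on (\<lambda>(g, a). const a * act g (var 0)) (R \<times> (UNIV - {0}))"
  proof (rule inj_onI)
    fix x y
    assume "x \<in> R \<times> (UNIV - {0})" "y \<in> R \<times> (UNIV - {0})"
      "(\<lambda>(g, a). const a * act g (var 0)) x = (\<lambda>(g, a). const a * act g (var 0)) y"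
    then show "x = y"
      using uniq[of "fst x" "fst y" "snd x" "snd y"] by (simp add: case_prod_beta mem_Times_iff prod_eq_iff)
  qed
  have mem: "const a * act g (var 0) \<in> linear_forms n - {0}" if "g \<in> R" "a \<noteq> 0" for g a
    using act_var_linear_form[of g n n 0] RG[OF that(1)] act_var_0_neq_0[OF RG[OF that(1)] n] that
    by (auto simp: linear_form_scale dest: GL_carrier_mat)
  have surj: "v \<in> (\<lambda>(g, a). const a * act g (var 0)) ` (R \<times> (UNIV - {0}))"
    if v: "v \<in> linear_forms n - {0}" for v
  proof -
    obtain k where k: "k \<in> carrier (GL n)" "act k (var 0) = v" using GL_transitive[of v n] v by auto
    obtain g where g: "g \<in> R" "g \<in> k <#\<^bsub>GL n\<^esub> parabolic 1 (n - 1)" using ex1[OF k(1)] by blast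
    then obtain a where a: "act g (var 0) = const a * v" using lcoset_iff[OF n RG k(1)] k by auto
    moreover have "a \<noteq> 0" using a act_var_0_neq_0[OF RG[OF g(1)] n] by auto
    ultimately have "v = const (1 / a) * act g (var 0)"
      by (simp add: mult.assoc[symmetric] const_mult[symmetric])
    then show ?thesis using g(1) \<open>a \<noteq> 0\<close> by (auto intro!: image_eqI[of _ _ "(g, 1 / a)"])
  qed
  show ?thesis
  proof (rule bij_betw_imageI[OF inj], intro equalityI subsetI)
    fix v assume "v \<in> (\<lambda>(g, a). const a * act g (var 0)) ` (R \<times> (UNIV - {0}))"
    then obtain g a where "g \<in> R" "a \<noteq> 0" "v = const a * act g (var 0)" by auto
    then show "v \<in> linear_forms n - {0}" using mem by simp
  qed (rule surj)
qed

section \<open>Divisibility of transfers\<close>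

text \<open>The substitution eliminates variable \<open>j\<close> by means of the relation
  \<open>linear_form n c = 0\<close>. It is the identity modulo this form and sends the form to 0,
  so its kernel is the principal ideal of the form.\<close>

lemma linear_form_kill:
  fixes c :: "nat \<Rightarrow> 'a::field"
  assumes "j < n" "c j \<noteq> 0"
  obtains \<sigma> where "\<And>f. linear_form n c dvd f \<longleftrightarrow> subst \<sigma> f = 0"
    "\<And>d. subst \<sigma> (linear_form n d) = linear_form n d - const (d j / c j) * linear_form n c"
proof
  let ?v = "linear_form n c"
  let ?\<sigma> = "\<lambda>i. var i - (if i = j then const (1 / c j) * ?v else 0)"
  show lin: "subst ?\<sigma> (linear_form n d) = linear_form n d - const (d j / c j) * ?v" for d
  proof -
    have "subst ?\<sigma> (linear_form n d) =
        linear_form n d - (\<Sum>i<n. if i = j then const (d i) * (const (1 / c j) * ?v) else 0)"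
      unfolding subst_linear_form
      by (simp add: right_diff_distrib sum_subtractf linear_form_def[of n d]
          if_distrib[of "\<lambda>x. _ * x"] cong: if_cong)
    also have "(\<Sum>i<n. if i = j then const (d i) * (const (1 / c j) * ?v) else 0) = const (d j / c j) * ?v"
      using assms by (simp add: mult.assoc[symmetric] const_mult[symmetric])
    finally show ?thesis .
  qed
  fix f :: "'a mpoly"
  obtain N where "f \<in> polys N" using ex_polys by blast
  then have "?v dvd subst var f - subst ?\<sigma> f"
    by (rule subst_congruent) auto
  then have *: "?v dvd f - subst ?\<sigma> f" by (simp add: subst_id)
  have "subst ?\<sigma> ?v = 0" using assms by (simp only: lin) simp
  then show "?v dvd f \<longleftrightarrow> subst ?\<sigma> f = 0"
    using * by (auto simp: dvd_def subst_mult)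
qed

text \<open>The principal ideal of \<open>v\<close> is the kernel of a ring homomorphism into a
  domain.\<close>

lemma prime_elem_linear_form:
  fixes v :: "'a::field mpoly"
  assumes "v \<in> linear_forms n" "v \<noteq> 0" shows "prime_elem v"
proof -
  obtain c where v: "v = linear_form n c" using assms by auto
  obtain j where j: "j < n" "c j \<noteq> 0" using assms by (auto simp: v linear_form_eq_0_iff)
  obtain \<sigma> where \<sigma>: "\<And>f. v dvd f \<longleftrightarrow> subst \<sigma> f = 0"
    using linear_form_kill[of j n c, OF j] unfolding v by metis
  show ?thesis using assms(2) by (auto simp: prime_elem_def \<sigma> subst_mult)
qed

lemma linear_form_dvdD:
  fixes v w :: "'a::field mpoly"
  assumes "v \<in> linear_forms n" "w \<in> linear_forms n" "v \<noteq> 0" "v dvd w"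
  obtains a where "w = const a * v"
proof -
  obtain c d where vw: "v = linear_form n c" "w = linear_form n d" using assms by auto
  obtain j where j: "j < n" "c j \<noteq> 0" using assms by (auto simp: vw linear_form_eq_0_iff)
  show ?thesis
    using linear_form_kill[of j n c, OF j] assms(4) that unfolding vw by (metis eq_iff_diff_eq_0)
qed

lemma prime_elem_power_dvd_mult:
  fixes v :: "'b::idom"
  assumes "prime_elem v" "\<not> v dvd a" "v ^ k dvd a * b" shows "v ^ k dvd b"
  using assms(3)
proof (induction k arbitrary: b)
  case (Suc k)
  have "v dvd a * b" using Suc.prems dvd_mult_left[of v "v ^ k"] by simp
  then obtain b' where b: "b = v * b'" using assms prime_elem_dvd_mult_iff[of v a b] by auto
  have "v * v ^ k dvd v * (a * b')" using Suc.prems by (simp add: b ac_simps)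
  then have "v ^ k dvd a * b'" using assms(1) by (subst (asm) dvd_mult_cancel_left) auto
  then show ?case using Suc.IH[of b'] by (simp add: b mult_dvd_mono)
qed simp

lemma prime_elem_dvd_prodD: "prime_elem v \<Longrightarrow> v dvd prod f S \<Longrightarrow> \<exists>i\<in>S. v dvd f i"
  by (induction S rule: infinite_finite_induct)
    (auto simp: prime_elem_dvd_mult_iff dest: prime_elem_not_unit)

text \<open>The factors are split off one at a time: a prime \<open>v i\<close> divides none of the
  powers of the others, so its power passes to the remaining quotient.\<close>

lemma prod_prime_power_dvd:
  fixes v :: "'i \<Rightarrow> 'b::idom"
  assumes "finite S" "\<And>i. i \<in> S \<Longrightarrow> prime_elem (v i)" "\<And>i. i \<in> S \<Longrightarrow> v i ^ k dvd x"
    and "\<And>i j. i \<in> S \<Longrightarrow> j \<in> S \<Longrightarrow> v i dvd v j \<Longrightarrow> i = j"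
  shows "(\<Prod>i\<in>S. v i ^ k) dvd x"
  using assms
proof (induction S rule: finite_induct)
  case (insert i S)
  have "(\<Prod>i\<in>S. v i ^ k) dvd x"
  proof (rule insert.IH)
    fix j k assume "j \<in> S" "k \<in> S" "v j dvd v k"
    then show "j = k" using insert.prems(3)[of j k] by simp
  qed (use insert.prems(1,2) in simp_all)
  then obtain y where x: "x = (\<Prod>i\<in>S. v i ^ k) * y" ..
  have prime: "prime_elem (v i)" using insert.prems by simp
  have "\<not> v i dvd (\<Prod>i\<in>S. v i ^ k)"
  proof
    assume "v i dvd (\<Prod>i\<in>S. v i ^ k)"
    then obtain j where "j \<in> S" "v i dvd v j ^ k"
      using prime_elem_dvd_prodD[OF prime] by blast
    then have "i = j" using prime_elem_dvd_power[OF prime] insert.prems(3) by blast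
    then show False using \<open>j \<in> S\<close> insert.hyps by simp
  qed
  moreover have "v i ^ k dvd (\<Prod>i\<in>S. v i ^ k) * y" using insert.prems(2)[of i] by (simp add: x)
  ultimately have "v i ^ k dvd y" by (rule prime_elem_power_dvd_mult[OF prime])
  then show ?case using insert.hyps by (simp add: x mult.commute mult_dvd_mono)
qed simp

lemma invariantsD: "f \<in> invariants n H \<Longrightarrow> g \<in> H \<Longrightarrow> act g f = f"
  and invariants_polys: "f \<in> invariants n H \<Longrightarrow> f \<in> polys n"
  by (auto simp: invariants_def)

lemma invariants_const [simp]: "const c \<in> invariants n H"
  and invariants_mult: "f \<in> invariants n H \<Longrightarrow> g \<in> invariants n H \<Longrightarrow> f * g \<in> invariants n H"
  and invariants_power: "f \<in> invariants n H \<Longrightarrow> f ^ k \<in> invariants n H"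
  and invariants_uminus: "f \<in> invariants n H \<Longrightarrow> - f \<in> invariants n H"
  by (auto simp: invariants_def act_hom intro: polys_intros)

lemma invariants_0 [simp]: "0 \<in> invariants n H"
  using invariants_const[of 0] by simp

text \<open>Let \<open>f = y^e * f'\<close> with e positive and below \<open>CARD('a) - 1\<close>.
  Scaling y by \<open>a\<close> gives \<open>a^e * (g f') = f'\<close> by invariance, while
  \<open>g f'\<close> and \<open>f'\<close> agree modulo y. Choosing \<open>a^e\<close> different
  from 1 forces y to divide \<open>f'\<close>.\<close>

lemma var_0_power_dvd_dickson:
  fixes f :: "'a::finite_field mpoly"
  assumes "0 < n" "f \<in> dickson_algebra n" "var 0 dvd f"
  shows "var 0 ^ (CARD('a) - 1) dvd f"
proof -
  have var: "(var 0 :: 'a mpoly) \<in> polys n" using assms(1) by (rule polys_var)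
  have "var 0 ^ Suc e dvd f" if "Suc e \<le> CARD('a) - 1" for e
    using that
  proof (induction e)
    case (Suc e)
    let ?e = "Suc e"
    from Suc obtain f' where f': "f = var 0 ^ ?e * f'" by (auto elim: dvdE)
    have f'_polys: "f' \<in> polys n"
      by (rule polys_dvdD[OF invariants_polys[OF assms(2)] polys_power[OF var] _ f']) simp
    obtain a :: 'a where a: "a \<noteq> 0" "a ^ ?e \<noteq> 1" using exists_power_neq_1[of ?e, where 'a = 'a] Suc.prems by auto
    obtain g where g: "g \<in> carrier (GL n)" "act g (var 0) = const a * var 0"
      and cong: "\<And>f. f \<in> polys n \<Longrightarrow> var 0 dvd act g f - f"
      using torus_exists[OF assms(1) a(1)] by metis
    have "var 0 ^ ?e * (const (a ^ ?e) * act g f') = act g f"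
      unfolding f' act_hom g(2) power_mult_distrib const_power by (simp only: ac_simps)
    also have "\<dots> = var 0 ^ ?e * f'" using invariantsD[OF assms(2) g(1)] f' by simp
    finally have eq: "const (a ^ ?e) * act g f' = f'" using var by simp
    have "var 0 dvd const (a ^ ?e) * (act g f' - f')" using cong[OF f'_polys] by (rule dvd_mult)
    also have "const (a ^ ?e) * (act g f' - f') = const (1 - a ^ ?e) * f'"
      by (simp only: right_diff_distrib eq) (simp add: const_diff left_diff_distrib)
    finally have "var 0 dvd const (1 / (1 - a ^ ?e)) * (const (1 - a ^ ?e) * f')" by (rule dvd_mult)
    also have "\<dots> = f'" using a by (simp add: mult.assoc[symmetric] const_mult[symmetric] del: power_Suc)
    finally show ?case by (simp add: f' mult_dvd_mono)
  qed (use assms in simp)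
  \<comment> \<open>The induction starts at exponent \<open>Suc 0\<close>, so index
    \<open>CARD('a) - 2\<close> belongs to the exponent \<open>CARD('a) - 1\<close>.\<close>
  from this[of "CARD('a) - 2"] card_finite_field_gt_1[where 'a = 'a] show ?thesis
    by (simp add: Suc_diff_Suc numeral_2_eq_2)
qed

section \<open>The transfer as a sum over linear forms, over a finite field of order
  \<open>CARD('a)\<close>\<close>

locale parabolic_transversal =
  fixes n :: nat and R :: "'a::finite_field mat set"
  assumes n_pos: "0 < n" and R: "left_transversal R (GL n) (parabolic 1 (n - 1))"
begin

abbreviation "P \<equiv> parabolic 1 (n - 1) :: 'a mat set"
abbreviation "y \<equiv> var 0 :: 'a mpoly"
abbreviation "nonzero_forms \<equiv> linear_forms n - {0} :: 'a mpoly set"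

lemma card_minus_1_pos: "0 < CARD('a) - 1"
  using card_finite_field_gt_1[where 'a = 'a] by simp

lemma y_polys [simp]: "y \<in> polys n" and y_form: "y \<in> nonzero_forms" and y_nonzero: "y \<noteq> 0"
  using n_pos polys_var[of 0 n] var_eq_linear_form[of 0 n] by auto

lemma R_GL: "g \<in> R \<Longrightarrow> g \<in> carrier (GL n)"
  using R by (auto simp: left_transversal_def)

lemma parabolic_GL: "g \<in> P \<Longrightarrow> g \<in> carrier (GL n)"
  using parabolic_iff[OF n_pos] by blast

lemmas bij_forms = bij_betw_transversal_lines[OF n_pos R]

lemma finite_R: "finite R"
proof -
  have "finite (R \<times> (UNIV - {0 :: 'a}))" using bij_betw_finite[OF bij_forms] by simp
  moreover have "(1 :: 'a) \<in> UNIV - {0}" by simp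
  ultimately show ?thesis using finite_cartesian_productD1 by blast
qed

lemma card_R: "card R * (CARD('a) - 1) = CARD('a) ^ n - 1"
proof -
  have "(0 :: 'a mpoly) \<in> linear_forms n" by (metis linear_form_0 rangeI)
  then have "card nonzero_forms = CARD('a) ^ n - 1" by (simp add: card_Diff_singleton card_linear_forms)
  then show ?thesis
    using bij_betw_same_card[OF bij_forms] by (simp add: card_cartesian_product card_Diff_singleton)
qed

text \<open>The conjugate of \<open>u\<close> attached to the form \<open>v\<close>. For an
  invariant \<open>u\<close> of the parabolic subgroup the chosen \<open>g\<close> does not matter,
  and neither does scaling \<open>v\<close>.\<close>

definition lift :: "'a mpoly \<Rightarrow> 'a mpoly \<Rightarrow> 'a mpoly" where
  "lift u v = act (SOME g. g \<in> carrier (GL n) \<and> act g y = v) u"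

lemma lift_act:
  assumes "u \<in> invariants n P" "g \<in> carrier (GL n)" "act g y = const a * v" "a \<noteq> 0" "v \<in> nonzero_forms"
  shows "lift u v = act g u"
proof -
  let ?k = "SOME g. g \<in> carrier (GL n) \<and> act g y = v"
  have "\<exists>k. k \<in> carrier (GL n) \<and> act k y = v" using GL_transitive[of v n] assms(5) by blast
  from someI_ex[OF this] have k: "?k \<in> carrier (GL n)" "act ?k y = v" by auto
  have "act g y = const a * act ?k y" unfolding k(2) by (rule assms(3))
  from act_eq_if_scalar[OF n_pos assms(2) k(1) this assms(1)] have "act g u = act ?k u" .
  then show ?thesis by (simp add: lift_def)
qed

text \<open>All forms on a line give the same conjugate, so summing over nonzero forms counts each
  coset \<open>CARD('a) - 1\<close> times, and this number is -1 in the field.\<close>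

lemma transfer_eq_sum_lift:
  assumes "u \<in> invariants n P"
  shows "transfer R u = - (\<Sum>v\<in>nonzero_forms. lift u v)"
proof -
  have "(\<Sum>v\<in>nonzero_forms. lift u v) = (\<Sum>(g, a)\<in>R \<times> (UNIV - {0}). lift u (const a * act g y))"
    by (subst sum.reindex_bij_betw[OF bij_forms, symmetric]) (simp add: case_prod_beta)
  also have "\<dots> = (\<Sum>(g, a)\<in>R \<times> (UNIV - {0 :: 'a}). act g u)"
  proof (rule sum.cong[OF refl])
    fix z assume "z \<in> R \<times> (UNIV - {0 :: 'a})"
    then obtain g a where z: "z = (g, a)" and ga: "g \<in> R" "a \<noteq> 0" by auto
    have m: "const a * act g y \<in> nonzero_forms" using bij_betw_apply[OF bij_forms, of "(g, a)"] ga by simp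
    have e: "act g y = const (1 / a) * (const a * act g y)"
      using ga by (simp add: mult.assoc[symmetric] const_mult[symmetric])
    have "lift u (const a * act g y) = act g u"
      by (rule lift_act[OF assms R_GL[OF ga(1)] e _ m]) (use ga in simp)
    then show "(case z of (g, a) \<Rightarrow> lift u (const a * act g y)) = (case z of (g, a) \<Rightarrow> act g u)"
      by (simp add: z)
  qed
  also have "\<dots> = (\<Sum>g\<in>R. of_nat (CARD('a) - 1) * act g u)"
    by (simp add: sum.cartesian_product[symmetric] card_Diff_singleton)
  also have "\<dots> = - transfer R u"
    unfolding of_nat_mpoly of_nat_card_minus_1 by (simp add: const_uminus sum_negf transfer_def)
  finally show ?thesis by simp
qed

lemma lift_polys:
  assumes "u \<in> invariants n P" "v \<in> nonzero_forms" shows "lift u v \<in> polys n"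
proof -
  obtain g where g: "g \<in> carrier (GL n)" "act g y = v" using GL_transitive[of v n] assms by auto
  then have "lift u v = act g u" using assms by (intro lift_act[of _ _ 1]) auto
  then show ?thesis using g assms by (auto intro: act_polys invariants_polys)
qed

text \<open>If \<open>g\<close> carries y to \<open>v\<close>, then \<open>k * g\<close> carries y
  to \<open>act k v\<close>.\<close>

lemma act_lift:
  assumes "u \<in> invariants n P" "v \<in> nonzero_forms" "k \<in> carrier (GL n)"
  shows "act k (lift u v) = lift u (act k v)"
proof -
  obtain g where g: "g \<in> carrier (GL n)" "act g y = v" using GL_transitive[of v n] assms by auto
  have "lift u (act k v) = act (k * g) u"
    using g assms bij_betw_apply[OF act_image_nonzero_linear_forms[OF assms(3)] assms(2)]
    by (intro lift_act[of _ _ 1]) (auto simp: act_GL_mult intro: GL_mult)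
  also have "\<dots> = act k (act g u)"
    using g assms by (intro act_GL_mult) (auto intro: invariants_polys)
  also have "act g u = lift u v" using g assms by (intro lift_act[of _ _ 1, symmetric]) auto
  finally show ?thesis ..
qed

text \<open>The sum over all nonzero forms no longer mentions representatives, and the group merely
  permutes its summands.\<close>

lemma transfer_dickson:
  assumes "u \<in> invariants n P" shows "transfer R u \<in> dickson_algebra n"
proof -
  have "act k (transfer R u) = transfer R u" if k: "k \<in> carrier (GL n)" for k
  proof -
    have "act k (transfer R u) = - (\<Sum>v\<in>nonzero_forms. lift u (act k v))"
      using assms k by (simp add: transfer_eq_sum_lift act_hom act_lift)
    also have "\<dots> = - (\<Sum>v\<in>nonzero_forms. lift u v)"
      by (subst sum.reindex_bij_betw[OF act_image_nonzero_linear_forms[OF k]]) simp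
    finally show ?thesis using assms by (simp add: transfer_eq_sum_lift)
  qed
  moreover have "transfer R u \<in> polys n"
    unfolding transfer_def
    by (auto intro!: polys_sum act_polys[OF GL_carrier_mat[OF R_GL]] invariants_polys[OF assms])
  ultimately show ?thesis by (simp add: invariants_def)
qed

text \<open>Modulo \<open>y\<close>, the summands for \<open>w + a y\<close> with \<open>a\<close> ranging over the field agree, because a
  transvection that is the identity modulo \<open>y\<close> maps \<open>w\<close> to \<open>w + a y\<close>; so they add up to a
  multiple of the characteristic.\<close>

lemma y_dvd_transfer:
  assumes u: "u \<in> invariants n P" and uy: "u * y ^ (CARD('a) - 1) \<in> invariants n P"
  shows "y dvd transfer R (u * y ^ (CARD('a) - 1))"
proof -
  \<comment> \<open>The value of \<open>lift u\<close> at 0 is unspecified, but the second factor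
    makes \<open>t 0 = 0\<close>, so that sums of \<open>t\<close> may run over all linear
    forms.\<close>
  define t where "t v = lift u v * v ^ (CARD('a) - 1)" for v
  \<comment> \<open>\<open>F0\<close> consists of the forms without y. They represent the linear
    forms modulo y: each form is \<open>w + const a * y\<close> for exactly one \<open>w\<close> in
    \<open>F0\<close> and one \<open>a\<close>.\<close>
  define F0 where "F0 = linear_form n ` {c. c 0 = (0 :: 'a)}"
  have lift_t: "lift (u * y ^ (CARD('a) - 1)) v = t v" if v: "v \<in> nonzero_forms" for v
  proof -
    obtain g where g: "g \<in> carrier (GL n)" "act g y = v" using GL_transitive[of v n] v by auto
    then have "lift (u * y ^ (CARD('a) - 1)) v = act g (u * y ^ (CARD('a) - 1))" "lift u v = act g u"
      using assms v by (auto intro: lift_act[of _ _ 1])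
    then show ?thesis by (simp add: t_def act_hom g)
  qed
  have zero: "(0 :: 'a mpoly) \<in> linear_forms n" by (metis linear_form_0 rangeI)
  have "inj_on (\<lambda>(w, a). w + const a * y) (F0 \<times> UNIV)"
  proof (rule inj_onI)
    fix z z' assume "z \<in> F0 \<times> (UNIV :: 'a set)" "z' \<in> F0 \<times> (UNIV :: 'a set)"
      and eq: "(\<lambda>(w, a). w + const a * y) z = (\<lambda>(w, a). w + const a * y) z'"
    then obtain c c' :: "nat \<Rightarrow> 'a" and a a' :: 'a
      where z: "z = (linear_form n c, a)" "c 0 = 0" "z' = (linear_form n c', a')" "c' 0 = 0"
      by (auto simp: F0_def)
    have "\<forall>i<n. c i + a * (if i = 0 then 1 else 0) = c' i + a' * (if i = 0 then 1 else 0)"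
      using eq unfolding z(1,3) prod.case var_eq_linear_form[OF n_pos] linear_form_scale
        linear_form_add linear_form_eq_iff .
    then have eqs: "c i + a * (if i = 0 then 1 else 0) = c' i + a' * (if i = 0 then 1 else 0)" if "i < n" for i
      using that by blast
    have "a = a'" using eqs[OF n_pos] z(2,4) by simp
    moreover have "linear_form n c = linear_form n c'"
    proof (rule linear_form_cong)
      fix i assume "i < n"
      then show "c i = c' i" using eqs[of i] z(2,4) by (cases "i = 0") simp_all
    qed
    ultimately show "z = z'" by (simp add: z)
  qed
  moreover have "(\<lambda>(w, a). w + const a * y) ` (F0 \<times> UNIV) = linear_forms n"
  proof (intro equalityI subsetI)
    fix v :: "'a mpoly" assume "v \<in> (\<lambda>(w, a). w + const a * y) ` (F0 \<times> UNIV)"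
    then obtain c and a :: 'a where "v = linear_form n c + const a * y" by (auto simp: F0_def)
    then show "v \<in> linear_forms n"
      unfolding var_eq_linear_form[OF n_pos] linear_form_scale linear_form_add by simp
  next
    fix v :: "'a mpoly" assume "v \<in> linear_forms n"
    then obtain c :: "nat \<Rightarrow> 'a" where v: "v = linear_form n c" by auto
    have "v = linear_form n (c(0 := 0)) + const (c 0) * y"
      unfolding v var_eq_linear_form[OF n_pos] linear_form_scale linear_form_add
      by (intro linear_form_cong) auto
    then show "v \<in> (\<lambda>(w, a). w + const a * y) ` (F0 \<times> UNIV)"
      by (auto simp: F0_def intro!: image_eqI[of _ _ "(linear_form n (c(0 := 0)), c 0)"])
  qed
  ultimately have bij: "bij_betw (\<lambda>(w, a). w + const a * y) (F0 \<times> UNIV) (linear_forms n)"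
    by (simp add: bij_betw_def)
  have "y dvd (\<Sum>a\<in>UNIV. t (w + const a * y))" if w: "w \<in> F0" for w
  proof (cases "w = 0")
    case True
    \<comment> \<open>On the line of y each summand is divisible by y on its own, through its factor
      \<open>(const a * y) ^ (CARD('a) - 1)\<close>.\<close>
    have "y dvd t (const a * y)" for a
      using card_minus_1_pos by (simp add: t_def power_mult_distrib dvd_power)
    then show ?thesis using True by (auto intro: dvd_sum)
  next
    case False
    obtain c where c: "w = linear_form n c" "c 0 = 0" using w by (auto simp: F0_def)
    with False obtain j where j: "j < n" "c j \<noteq> 0" by (auto simp: linear_form_eq_0_iff)
    then have "0 < j" using c by (cases j) auto
    have wf: "w \<in> nonzero_forms" using False c by simp
    have "y dvd t (w + const a * y) - t w" for a
    proof -
      obtain g where g: "g \<in> carrier (GL n)" "act g w = w + const a * y"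
        and cong: "\<And>f. f \<in> polys n \<Longrightarrow> y dvd act g f - f"
        using transvection_exists[of j n c a] \<open>0 < j\<close> j c(1) by metis
      have "act g (t w) = t (w + const a * y)"
        using act_lift[OF u wf g(1)] by (simp add: t_def act_hom g)
      moreover have "t w \<in> polys n"
        unfolding t_def using lift_polys[OF u wf] c by (auto intro!: polys_mult polys_power)
      ultimately show ?thesis using cong by metis
    qed
    then have "y dvd (\<Sum>a\<in>UNIV. t (w + const a * y) - t w)" by (intro dvd_sum)
    \<comment> \<open>The subtracted terms are \<open>CARD('a)\<close> copies of \<open>t w\<close>
      and add up to zero.\<close>
    also have "\<dots> = (\<Sum>a\<in>UNIV. t (w + const a * y))"
      by (simp add: sum_subtractf of_nat_mpoly of_nat_card_finite_field)
    finally show ?thesis .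
  qed
  then have "y dvd (\<Sum>w\<in>F0. \<Sum>a\<in>UNIV. t (w + const a * y))" by (rule dvd_sum)
  also have "\<dots> = (\<Sum>v\<in>linear_forms n. t v)"
    unfolding sum.reindex_bij_betw[OF bij, symmetric] by (simp add: sum.cartesian_product case_prod_beta)
  also have "\<dots> = (\<Sum>v\<in>nonzero_forms. t v)"
    using card_minus_1_pos zero by (subst sum.remove[of _ 0]) (auto simp: t_def)
  also have "\<dots> = - transfer R (u * y ^ (CARD('a) - 1))"
    unfolding transfer_eq_sum_lift[OF uy] minus_minus by (rule sum.cong[OF refl lift_t[symmetric]])
  finally show ?thesis by simp
qed

section \<open>The conjugates of h and the Dickson invariant of highest degree\<close>

text \<open>The conjugate of h under \<open>g\<close>; the exponent makes it depend only on the line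
  of \<open>act g y\<close>.\<close>

definition root :: "'a mat \<Rightarrow> 'a mpoly" where "root g = act g y ^ (CARD('a) - 1)"

text \<open>This is the \<open>c\<^sub>0\<close> of the outline, equal to the product of all nonzero
  linear forms.\<close>

definition dickson_top :: "'a mpoly" where "dickson_top = (\<Prod>g\<in>R. - root g)"

lemma act_y_form: "g \<in> carrier (GL n) \<Longrightarrow> act g y \<in> nonzero_forms"
  using bij_betw_apply[OF act_image_nonzero_linear_forms y_form] .

lemma act_y_scalar_eq:
  assumes "g \<in> R" "k \<in> R" "act g y = const a * act k y" shows "g = k"
proof -
  have "a \<noteq> 0" using assms act_y_form[OF R_GL] by force
  then have "(g, 1) = (k, a)"
    using assms by (intro inj_onD[OF bij_betw_imp_inj_on[OF bij_forms]]) auto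
  then show ?thesis by simp
qed

lemma inj_on_root: "inj_on root R"
proof (rule inj_onI)
  fix g k assume gk: "g \<in> R" "k \<in> R" "root g = root k"
  then obtain a where "act g y = const a * act k y"
    using eq_scalar_multiple_if_power_eq[of "act g y" "act k y"] act_y_form[OF R_GL] unfolding root_def by auto
  then show "g = k" using act_y_scalar_eq gk by blast
qed

text \<open>The power \<open>y^(CARD('a) - 1)\<close> divides \<open>f\<close>, and by invariance so
  do its conjugates. These are powers of primes on different lines, hence their product divides
  \<open>f\<close>.\<close>

lemma dickson_top_dvd:
  assumes "f \<in> dickson_algebra n" "y dvd f" shows "dickson_top dvd f"
proof -
  have "(\<Prod>g\<in>R. act g y ^ (CARD('a) - 1)) dvd f"
  proof (rule prod_prime_power_dvd[OF finite_R])
    fix g assume g: "g \<in> R"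
    show "prime_elem (act g y)" using prime_elem_linear_form act_y_form[OF R_GL[OF g]] by blast
    obtain f' where "f = y ^ (CARD('a) - 1) * f'" using var_0_power_dvd_dickson[OF n_pos assms] ..
    then have "act g f = act g y ^ (CARD('a) - 1) * act g f'" by (simp add: act_hom)
    then show "act g y ^ (CARD('a) - 1) dvd f" using invariantsD[OF assms(1) R_GL[OF g]] by simp
    fix k assume k: "k \<in> R" and dvd: "act g y dvd act k y"
    obtain a where "act k y = const a * act g y"
      using linear_form_dvdD[OF _ _ _ dvd, of n] act_y_form[OF R_GL[OF g]] act_y_form[OF R_GL[OF k]]
      by (metis DiffE singletonI)
    then show "g = k" using act_y_scalar_eq g k by metis
  qed
  then show ?thesis
    by (cases "even (card R)") (simp_all add: dickson_top_def root_def prod_uminus)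
qed

text \<open>On each line the product of the negated forms is the value at \<open>x = 0\<close> of
  the factorization of \<open>x^(CARD('a) - 1) - root g\<close>.\<close>

lemma dickson_top_eq: "dickson_top = (\<Prod>v\<in>nonzero_forms. - v)"
proof -
  have "(\<Prod>v\<in>nonzero_forms. - v) = (\<Prod>(g, a)\<in>R \<times> (UNIV - {0}). - (const a * act g y))"
    by (subst prod.reindex_bij_betw[OF bij_forms, symmetric]) (simp add: case_prod_beta)
  also have "\<dots> = (\<Prod>g\<in>R. \<Prod>a\<in>UNIV - {0}. 0 - const a * act g y)"
    by (simp add: prod.cartesian_product)
  also have "\<dots> = dickson_top"
    unfolding dickson_top_def
  proof (rule prod.cong[OF refl])
    fix g assume "g \<in> R"
    then have "act g y \<noteq> 0" using act_y_form[OF R_GL] by blast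
    from prod_diff_scalar_multiples[OF this, of 0]
    show "(\<Prod>a\<in>UNIV - {0}. 0 - const a * act g y) = - root g"
      using card_minus_1_pos by (simp add: root_def)
  qed
  finally show ?thesis ..
qed

lemma dickson_top_dickson: "dickson_top \<in> dickson_algebra n"
proof -
  have "act k dickson_top = dickson_top" if k: "k \<in> carrier (GL n)" for k
  proof -
    have "act k dickson_top = (\<Prod>v\<in>nonzero_forms. - act k v)"
      by (simp add: dickson_top_eq act_hom)
    also have "\<dots> = dickson_top"
      unfolding dickson_top_eq by (rule prod.reindex_bij_betw[OF act_image_nonzero_linear_forms[OF k]])
    finally show ?thesis .
  qed
  moreover have "dickson_top \<in> polys n"
    unfolding dickson_top_eq by (auto intro!: polys_prod polys_uminus)
  ultimately show ?thesis by (simp add: invariants_def)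
qed

lemma dickson_top_nonzero: "dickson_top \<noteq> 0"
  unfolding dickson_top_eq by (simp add: prod_zero_iff)

end

section \<open>Expansion in powers of \<open>h\<close>\<close>

lemma coeff_linear_factor_mult:
  "coeff ([:- r, 1:] * p) m = (case m of 0 \<Rightarrow> 0 | Suc k \<Rightarrow> coeff p k) - r * coeff p m"
  for r :: "'b::comm_ring_1"
  by (simp add: mult_pCons_left coeff_pCons split: nat.split)

lemma act_coeff_prod: "act k (coeff (\<Prod>r\<in>S. [:- r, 1:]) m) = coeff (\<Prod>r\<in>S. [:- act k r, 1:]) m"
  by (induction S arbitrary: m rule: infinite_finite_induct)
    (auto simp: coeff_linear_factor_mult act_hom simp del: mult_pCons_left split: nat.split)

lemma coeff_prod_polys:
  "(\<And>r. r \<in> S \<Longrightarrow> r \<in> polys n) \<Longrightarrow> coeff (\<Prod>r\<in>S. [:- r, 1:]) m \<in> polys n"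
  by (induction S arbitrary: m rule: infinite_finite_induct)
    (auto simp: coeff_linear_factor_mult simp del: mult_pCons_left intro!: polys_intros split: nat.split)

context parabolic_transversal
begin

abbreviation "h \<equiv> y ^ (CARD('a) - 1)"

text \<open>Describing the conjugates without \<open>R\<close> makes it evident that the whole group
  permutes them.\<close>

lemma root_image: "root ` R = (\<lambda>v. v ^ (CARD('a) - 1)) ` nonzero_forms"
proof (intro equalityI subsetI)
  fix r assume "r \<in> root ` R"
  then show "r \<in> (\<lambda>v. v ^ (CARD('a) - 1)) ` nonzero_forms"
    using act_y_form[OF R_GL] unfolding root_def by blast
next
  fix r assume "r \<in> (\<lambda>v. v ^ (CARD('a) - 1)) ` nonzero_forms"
  then obtain v where v: "v \<in> nonzero_forms" "r = v ^ (CARD('a) - 1)" by blast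
  from v(1) obtain g a where ga: "g \<in> R" "a \<noteq> 0" "v = const a * act g y"
    unfolding bij_betw_imp_surj_on[OF bij_forms, symmetric] by auto
  have "r = root g"
    unfolding v(2) ga(3) root_def power_mult_distrib const_power[symmetric] power_card_minus_1[OF ga(2)] by simp
  then show "r \<in> root ` R" using ga(1) by blast
qed

lemma act_root_image:
  assumes "k \<in> carrier (GL n)" shows "act k ` root ` R = root ` R"
proof -
  have "act k ` root ` R = (\<lambda>v. v ^ (CARD('a) - 1)) ` act k ` nonzero_forms"
    unfolding root_image image_image by (simp add: act_hom)
  also have "act k ` nonzero_forms = nonzero_forms"
    using act_image_nonzero_linear_forms[OF assms] by (simp add: bij_betw_def)
  finally show ?thesis by (simp add: root_image)
qed

lemma root_polys: "g \<in> R \<Longrightarrow> root g \<in> polys n"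
  unfolding root_def by (intro polys_power act_polys[OF GL_carrier_mat[OF R_GL] y_polys])

text \<open>For \<open>s = h\<close> this is the \<open>G\<close> of the outline; for other
  conjugates it is the numerator of the Lagrange polynomial at \<open>s\<close>. Indexing by the set
  of roots rather than by \<open>R\<close> lets the group act on it.\<close>

definition cofactor :: "'a mpoly \<Rightarrow> 'a mpoly poly" where
  "cofactor s = (\<Prod>r\<in>root ` R - {s}. [:- r, 1:])"

text \<open>The group permutes the conjugates, so those other than \<open>s\<close> go to those
  other than \<open>act k s\<close>.\<close>

lemma act_cofactor:
  assumes k: "k \<in> carrier (GL n)" and s: "s \<in> root ` R"
  shows "act k (coeff (cofactor s) m) = coeff (cofactor (act k s)) m"
proof -
  have inj: "inj_on (act k) (root ` R)"
    using root_polys by (intro inj_on_subset[OF inj_on_act[OF k]]) auto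
  have "act k ` (root ` R - {s}) = root ` R - {act k s}"
    using inj_on_image_set_diff[OF inj, of "root ` R" "{s}"] s by (simp add: act_root_image[OF k])
  then have "(\<Prod>r\<in>root ` R - {s}. [:- act k r, 1:]) = cofactor (act k s)"
    unfolding cofactor_def
    using prod.reindex[OF inj_on_subset[OF inj], of "root ` R - {s}" "\<lambda>r. [:- r, 1:]"] by (simp add: o_def)
  then show ?thesis unfolding cofactor_def act_coeff_prod by simp
qed

lemma poly_cofactor:
  assumes "g \<in> R" shows "poly (cofactor (root g)) x = (\<Prod>k\<in>R - {g}. x - root k)"
proof -
  have "root ` R - {root g} = root ` (R - {g})"
    using inj_on_image_set_diff[OF inj_on_root, of R "{g}"] assms by simp
  then show ?thesis
    unfolding cofactor_def poly_prod
    using prod.reindex[OF inj_on_subset[OF inj_on_root], of "R - {g}" "\<lambda>r. poly [:- r, 1:] x"] by simp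
qed

lemma card_R_pos: "0 < card R"
proof -
  have "R \<noteq> {}" using bij_betw_imp_surj_on[OF bij_forms] y_form by force
  then show ?thesis using finite_R by (simp add: card_gt_0_iff)
qed

lemma poly_cofactor_sum:
  assumes "s \<in> root ` R"
  shows "poly (cofactor s) x = (\<Sum>m<card R. coeff (cofactor s) m * x ^ m)"
proof -
  have "degree (cofactor s) = card (root ` R - {s})"
    unfolding cofactor_def by (subst degree_prod_eq_sum_degree) auto
  also have "\<dots> = card R - 1"
    using assms finite_R by (simp add: card_Diff_singleton card_image[OF inj_on_root])
  finally show ?thesis
    using card_R_pos by (simp add: poly_altdef lessThan_Suc_atMost[symmetric])
qed

lemma act_parabolic_h:
  assumes "g \<in> P" shows "act g h = h"
proof -
  obtain a where a: "act g y = const a * y" using assms parabolic_iff_scalar[OF n_pos] by blast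
  have "a \<noteq> 0" using a act_var_0_neq_0[OF parabolic_GL[OF assms] n_pos] by auto
  then show ?thesis
    unfolding act_hom a power_mult_distrib const_power[symmetric] by (subst power_card_minus_1) simp_all
qed

lemma h_invariant: "h \<in> invariants n P"
  using act_parabolic_h by (simp add: invariants_def polys_power)

text \<open>The representative of the coset of the identity. It may differ from the identity matrix,
  but it lies in \<open>P\<close> and only scales y.\<close>

lemma ex_base:
  obtains g a where "g \<in> R" "g \<in> P" "a \<noteq> 0" "act g y = const a * y"
proof -
  obtain g a where ga: "g \<in> R" "a \<noteq> 0" "y = const a * act g y"
    using y_form unfolding bij_betw_imp_surj_on[OF bij_forms, symmetric] by auto
  have "act g y = const (1 / a) * y"
    using scalar_multiple_swap[of a "act g y" 1 y] ga by simp
  moreover from this have "g \<in> P" using parabolic_iff_scalar[OF n_pos] R_GL[OF ga(1)] by blast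
  ultimately show ?thesis using that[of g "1 / a"] ga by simp
qed

lemma root_parabolic: "g \<in> P \<Longrightarrow> root g = h"
  using act_parabolic_h by (simp add: root_def act_hom)

lemma h_root: "h \<in> root ` R"
  using ex_base root_parabolic by (metis imageI)

lemma cofactor_invariant: "coeff (cofactor h) m \<in> invariants n P"
proof -
  have "coeff (cofactor h) m \<in> polys n"
    unfolding cofactor_def using root_polys by (intro coeff_prod_polys) auto
  moreover have "act g (coeff (cofactor h) m) = coeff (cofactor h) m" if "g \<in> P" for g
    unfolding act_cofactor[OF parabolic_GL[OF that] h_root] act_parabolic_h[OF that] ..
  ultimately show ?thesis by (simp add: invariants_def)
qed

text \<open>At 0 the cofactor is the product defining \<open>dickson_top\<close> without its factor
  \<open>- h\<close>.\<close>

lemma h_mult_cofactor_0: "h * poly (cofactor h) 0 = - dickson_top"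
proof -
  obtain g where g: "g \<in> R" "g \<in> P" using ex_base .
  then have "dickson_top = - h * (\<Prod>k\<in>R - {g}. - root k)"
    unfolding dickson_top_def prod.remove[OF finite_R g(1)] by (simp only: root_parabolic)
  then show ?thesis using poly_cofactor[OF g(1), of 0] root_parabolic[OF g(2)] by simp
qed

text \<open>Both values are products over the linear forms \<open>v\<close> that are not multiples of \<open>y\<close>, of
  \<open>y - v\<close> and \<open>- v\<close> respectively, and this set of forms is invariant under translation by \<open>y\<close>.\<close>

lemma cofactor_h_eq_cofactor_0: "poly (cofactor h) h = poly (cofactor h) 0"
proof -
  obtain g0 a where g0: "g0 \<in> R" "g0 \<in> P" "a \<noteq> 0" "act g0 y = const a * y" using ex_base .
  define A where "A = linear_forms n - range (\<lambda>a. const a * y)"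
  let ?\<phi> = "\<lambda>(g, a). const a * act g y"
  have "?\<phi> ` ((R - {g0}) \<times> (UNIV - {0})) = A"
  proof (intro equalityI subsetI)
    fix v assume "v \<in> ?\<phi> ` ((R - {g0}) \<times> (UNIV - {0}))"
    then obtain g b where gb: "g \<in> R" "g \<noteq> g0" "b \<noteq> 0" "v = const b * act g y" by auto
    have "v \<in> nonzero_forms" using bij_betw_apply[OF bij_forms, of "(g, b)"] gb by simp
    moreover have "v \<noteq> const c * y" for c
    proof
      assume "v = const c * y"
      then have "act g y = const (c / b) * y" using gb by (intro scalar_multiple_swap) auto
      also have "\<dots> = const (c / b) * (const (1 / a) * act g0 y)"
        using scalar_multiple_swap[of a y 1 "act g0 y"] g0 by simp
      finally have "act g y = const (c / b / a) * act g0 y"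
        by (simp add: mult.assoc[symmetric] const_mult[symmetric])
      then show False using act_y_scalar_eq gb g0 by blast
    qed
    ultimately show "v \<in> A" by (auto simp: A_def)
  next
    fix v assume v: "v \<in> A"
    then have "v \<noteq> const 0 * y" unfolding A_def by blast
    then have "v \<in> nonzero_forms" using v by (simp add: A_def)
    then obtain g b where gb: "g \<in> R" "b \<noteq> 0" "v = const b * act g y"
      unfolding bij_betw_imp_surj_on[OF bij_forms, symmetric] by auto
    have "g \<noteq> g0"
    proof
      assume "g = g0"
      then have "v = const (b * a) * y" using gb g0 by (simp add: const_mult mult.assoc)
      then show False using v by (auto simp: A_def)
    qed
    then show "v \<in> ?\<phi> ` ((R - {g0}) \<times> (UNIV - {0}))"
      using gb by (auto intro!: image_eqI[of _ _ "(g, b)"])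
  qed
  then have bij: "bij_betw ?\<phi> ((R - {g0}) \<times> (UNIV - {0})) A"
    by (intro bij_betw_subset[OF bij_forms]) auto
  \<comment> \<open>At an argument \<open>x^(CARD('a) - 1)\<close> each factor splits into the
    differences of \<open>x\<close> and the nonzero multiples of one \<open>act g y\<close>;
    together these multiples are the forms off the line of y.\<close>
  have *: "poly (cofactor h) (x ^ (CARD('a) - 1)) = (\<Prod>v\<in>A. x - v)" for x
  proof -
    have "(\<Prod>v\<in>A. x - v) = (\<Prod>(g, a)\<in>(R - {g0}) \<times> (UNIV - {0}). x - const a * act g y)"
      by (subst prod.reindex_bij_betw[OF bij, symmetric]) (simp add: case_prod_beta)
    also have "\<dots> = (\<Prod>g\<in>R - {g0}. \<Prod>a\<in>UNIV - {0}. x - const a * act g y)"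
      by (simp add: prod.cartesian_product)
    also have "\<dots> = (\<Prod>g\<in>R - {g0}. x ^ (CARD('a) - 1) - root g)"
    proof (rule prod.cong[OF refl])
      fix g assume "g \<in> R - {g0}"
      then have "act g y \<noteq> 0" using act_y_form[OF R_GL] by blast
      from prod_diff_scalar_multiples[OF this]
      show "(\<Prod>a\<in>UNIV - {0}. x - const a * act g y) = x ^ (CARD('a) - 1) - root g"
        unfolding root_def .
    qed
    also have "\<dots> = poly (cofactor h) (x ^ (CARD('a) - 1))"
      using poly_cofactor[OF g0(1)] root_parabolic[OF g0(2)] by simp
    finally show ?thesis ..
  qed
  have shift: "v + const e * y \<in> A" if v: "v \<in> A" for v e
  proof -
    obtain c where c: "v = linear_form n c" using v by (auto simp: A_def)
    have "v + const e * y \<in> linear_forms n"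
      unfolding c var_eq_linear_form[OF n_pos] linear_form_scale linear_form_add by simp
    moreover have "v + const e * y \<noteq> const b * y" for b
    proof
      assume "v + const e * y = const b * y"
      then have "v = const (b - e) * y" by (simp add: const_diff algebra_simps)
      then show False using v by (auto simp: A_def)
    qed
    ultimately show ?thesis by (auto simp: A_def)
  qed
  have "(\<Prod>v\<in>A. y - v) = (\<Prod>v\<in>A. 0 - v)"
    using shift[of _ 1] shift[of _ "- 1"]
    by (intro prod.reindex_bij_witness[of _ "\<lambda>v. v + y" "\<lambda>v. v - y"]) (auto simp: const_uminus)
  then show ?thesis
    using *[of y] *[of 0] card_minus_1_pos by (simp add: power_0_left)
qed

text \<open>The transfer is invariant and divisible by y, hence by \<open>dickson_top\<close>. Since
  that divisor is invariant and nonzero, cancelling it shows the quotient to be invariant.\<close>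

lemma transfer_dvd:
  assumes "u \<in> invariants n P"
  obtains c where "c \<in> dickson_algebra n" "transfer R (u * h) = dickson_top * c"
proof -
  have uh: "u * h \<in> invariants n P" using assms h_invariant by (rule invariants_mult)
  have T: "transfer R (u * h) \<in> dickson_algebra n" by (rule transfer_dickson[OF uh])
  obtain c where c: "transfer R (u * h) = dickson_top * c"
    using dickson_top_dvd[OF T y_dvd_transfer[OF assms uh]] ..
  have "c \<in> polys n"
    by (rule polys_dvdD[OF invariants_polys[OF T] invariants_polys[OF dickson_top_dickson] dickson_top_nonzero c])
  moreover have "act k c = c" if k: "k \<in> carrier (GL n)" for k
  proof -
    have "dickson_top * act k c = act k (dickson_top * c)"
      using invariantsD[OF dickson_top_dickson k] by (simp add: act_hom)
    also have "\<dots> = dickson_top * c" using invariantsD[OF T k] c by simp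
    finally show ?thesis using dickson_top_nonzero by simp
  qed
  ultimately have "c \<in> dickson_algebra n" by (simp add: invariants_def)
  then show ?thesis using c by (rule that)
qed

section \<open>Existence and uniqueness of expansions, and the resulting basis\<close>

lemma expansion_exists:
  assumes f: "f \<in> invariants n P"
  obtains c where "\<And>m. c m \<in> dickson_algebra n" "f = (\<Sum>m<card R. c m * h ^ m)" "c 0 = transfer R f"
proof -
  let ?u = "\<lambda>m. f * coeff (cofactor h) m"
  have "\<exists>c. c \<in> dickson_algebra n \<and> transfer R (?u m * h) = dickson_top * c" for m
    using transfer_dvd[OF invariants_mult[OF f cofactor_invariant]] by metis
  then obtain d where d: "\<And>m. d m \<in> dickson_algebra n"
    "\<And>m. transfer R (?u m * h) = dickson_top * d m" by metis
  obtain g0 where g0: "g0 \<in> R" "g0 \<in> P" using ex_base .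
  have act_h: "act g h = root g" for g by (simp add: root_def act_hom)
  \<comment> \<open>Each transfer is written out over \<open>R\<close>; after exchanging the sums,
    the inner one assembles the cofactor of \<open>root g\<close> evaluated at
    \<open>h\<close>.\<close>
  have "(\<Sum>m<card R. dickson_top * d m * h ^ m) =
      (\<Sum>m<card R. \<Sum>g\<in>R. act g f * root g * (coeff (cofactor (root g)) m * h ^ m))"
    unfolding d(2)[symmetric] transfer_def sum_distrib_right
  proof (intro sum.cong refl)
    fix m g assume g: "g \<in> R"
    have "act g (coeff (cofactor h) m) = coeff (cofactor (root g)) m"
      using act_cofactor[OF R_GL[OF g] h_root] by (simp only: act_h)
    then have "act g (?u m * h) = act g f * coeff (cofactor (root g)) m * root g"
      unfolding act_hom(4) act_h by simp
    then show "act g (?u m * h) * h ^ m = act g f * root g * (coeff (cofactor (root g)) m * h ^ m)"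
      by (simp only: ac_simps)
  qed
  also have "\<dots> = (\<Sum>g\<in>R. act g f * root g * poly (cofactor (root g)) h)"
    by (subst sum.swap) (simp add: sum_distrib_left[symmetric] poly_cofactor_sum)
  \<comment> \<open>For \<open>g\<close> other than \<open>g0\<close> the conjugate
    \<open>h = root g0\<close> is among the roots of the cofactor of \<open>root g\<close>, so only
    the summand of \<open>g0\<close> survives.\<close>
  also have "\<dots> = act g0 f * root g0 * poly (cofactor (root g0)) h"
  proof -
    have "poly (cofactor (root g)) h = 0" if "g \<in> R - {g0}" for g
    proof -
      have "(\<Prod>k\<in>R - {g}. h - root k) = 0"
        using that g0 finite_R root_parabolic[OF g0(2)] by (intro prod_zero) (auto intro!: bexI[of _ g0])
      then show ?thesis using poly_cofactor[of g h] that by simp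
    qed
    then have "(\<Sum>g\<in>R - {g0}. act g f * root g * poly (cofactor (root g)) h) = 0"
      by (intro sum.neutral) simp
    then show ?thesis by (simp only: sum.remove[OF finite_R g0(1)] add_0_right)
  qed
  also have "\<dots> = - (dickson_top * f)"
    unfolding invariantsD[OF f g0(2)] root_parabolic[OF g0(2)] cofactor_h_eq_cofactor_0
      mult.assoc h_mult_cofactor_0 by simp
  finally have "dickson_top * f = dickson_top * (\<Sum>m<card R. - d m * h ^ m)"
    by (simp add: sum_distrib_left mult.assoc sum_negf)
  then have "f = (\<Sum>m<card R. - d m * h ^ m)" using dickson_top_nonzero by simp
  moreover have "- d 0 = transfer R f"
  proof -
    \<comment> \<open>The constant coefficient is the cofactor at 0, so the transfer is applied to
      an invariant multiple of \<open>f\<close>, and the invariant factor can be pulled out.\<close>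
    have "?u 0 * h = - (dickson_top * f)"
      using h_mult_cofactor_0 by (simp add: poly_0_coeff_0 mult.commute mult.left_commute)
    then have "dickson_top * - d 0 = - transfer R (- (dickson_top * f))"
      using d(2)[of 0] by simp
    also have "\<dots> = dickson_top * transfer R f"
      unfolding transfer_def sum_distrib_left sum_negf[symmetric]
      using invariantsD[OF dickson_top_dickson R_GL] by (intro sum.cong) (auto simp: act_hom)
    finally show ?thesis by (simp only: mult_left_cancel[OF dickson_top_nonzero])
  qed
  moreover have "- d m \<in> dickson_algebra n" for m using d(1) by (rule invariants_uminus)
  ultimately show ?thesis using that[of "\<lambda>m. - d m"] by blast
qed

text \<open>Applying \<open>g\<close> keeps the Dickson coefficients and replaces \<open>h\<close>
  by \<open>root g\<close>. Thus two polynomials of degree below \<open>card R\<close> agree at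
  \<open>card R\<close> distinct points.\<close>

lemma expansion_unique:
  assumes c: "\<And>m. c m \<in> dickson_algebra n" and d: "\<And>m. d m \<in> dickson_algebra n"
    and eq: "(\<Sum>m<card R. c m * h ^ m) = (\<Sum>m<card R. d m * h ^ m)" and "m < card R"
  shows "c m = d m"
proof -
  define p where "p e = (\<Sum>m<card R. Polynomial.monom (e m) m)" for e :: "nat \<Rightarrow> 'a mpoly"
  have coeff_p: "coeff (p e) m = (if m < card R then e m else 0)" for e m
    by (simp add: p_def coeff_sum)
  have deg: "card (root ` R) > degree (p e)" for e
  proof -
    have "degree (p e) \<le> card R - 1" by (intro degree_le) (auto simp: coeff_p)
    then show ?thesis using card_R_pos by (simp add: card_image[OF inj_on_root])
  qed
  have poly_p: "poly (p e) (root g) = act g (\<Sum>m<card R. e m * h ^ m)"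
    if "g \<in> R" and e: "\<And>m. e m \<in> dickson_algebra n" for g e
  proof -
    have "act g (\<Sum>m<card R. e m * h ^ m) = (\<Sum>m<card R. act g (e m) * root g ^ m)"
      by (simp add: act_hom root_def)
    also have "\<dots> = poly (p e) (root g)"
      using invariantsD[OF e R_GL[OF that(1)]] by (simp add: p_def poly_sum poly_monom)
    finally show ?thesis ..
  qed
  have "p c = p d"
  proof (rule poly_eqI_degree[OF _ deg deg])
    fix x assume "x \<in> root ` R"
    then obtain g where g: "g \<in> R" "x = root g" by blast
    show "poly (p c) x = poly (p d) x"
      unfolding g(2) poly_p[OF g(1) c] poly_p[OF g(1) d] eq ..
  qed
  then have "coeff (p c) m = coeff (p d) m" by simp
  then show ?thesis using \<open>m < card R\<close> by (simp add: coeff_p)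
qed

text \<open>Equal powers would make a positive power of \<open>h\<close> equal to 1, but y is not a
  unit. Basis elements can therefore be indexed by their exponents.\<close>

lemma inj_on_h_power: "inj (\<lambda>m. h ^ m)"
proof -
  have not_unit: "\<not> y dvd 1" using prime_elem_linear_form[of y n] y_form prime_elem_not_unit by blast
  have "h ^ i \<noteq> h ^ j" if "i < j" for i j
  proof
    assume "h ^ i = h ^ j"
    also have "h ^ j = h ^ i * h ^ (j - i)" using that by (simp add: power_add[symmetric])
    finally have "h ^ (j - i) = 1" by simp
    moreover have "y dvd h ^ (j - i)"
      using that card_minus_1_pos by (simp add: power_mult[symmetric] dvd_power)
    ultimately show False using not_unit by simp
  qed
  then show ?thesis by (intro linorder_injI) auto
qed

text \<open>It remains to pass from coefficients indexed by exponents to coordinate functions on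
  \<open>B\<close>; the basis element 1 is the power with exponent 0.\<close>

lemma
  assumes B: "B = {h ^ m | m. m < card R}"
  shows free_basis_h: "free_basis (dickson_algebra n) B (invariants n P)"
    and natural_epi_eq_transfer:
      "f \<in> invariants n P \<Longrightarrow> natural_epi (dickson_algebra n) B f = transfer R f"
proof -
  let ?D = "dickson_algebra n :: 'a mpoly set"
  have B': "B = (\<lambda>m. h ^ m) ` {..<card R}" using B by auto
  have inj: "inj_on (\<lambda>m. h ^ m) {..<card R}" using inj_on_h_power by (rule inj_on_subset) simp
  have finite_B: "finite B" by (simp add: B')
  have sum_B: "(\<Sum>b | C b \<noteq> 0. C b * b) = (\<Sum>m<card R. C (h ^ m) * h ^ m)"
    if "{b. C b \<noteq> 0} \<subseteq> B" for C
  proof -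
    have "(\<Sum>b | C b \<noteq> 0. C b * b) = (\<Sum>b\<in>B. C b * b)"
      using that finite_B by (intro sum.mono_neutral_left) auto
    then show ?thesis unfolding B' sum.reindex[OF inj] by simp
  qed
  have ex: "\<exists>C. coordinates ?D B f C \<and> C 1 = transfer R f" if f: "f \<in> invariants n P" for f
  proof -
    obtain c where c: "\<And>m. c m \<in> ?D" "f = (\<Sum>m<card R. c m * h ^ m)" "c 0 = transfer R f"
      using expansion_exists[OF f] by blast
    \<comment> \<open>Injectivity of the powers recovers the exponent from \<open>b\<close>; the
      value 0 outside \<open>B\<close> is the convention built into
      \<open>coordinates\<close>.\<close>
    define C where "C b = (if b \<in> B then c (inv_into UNIV (\<lambda>m. h ^ m) b) else 0)" for b
    have C: "C (h ^ m) = c m" if "m < card R" for m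
      using that inv_f_f[OF inj_on_h_power, of m] by (auto simp: C_def B')
    have supp: "{b. C b \<noteq> 0} \<subseteq> B" by (auto simp: C_def)
    then have "coordinates ?D B f C"
      using sum_B[OF supp] C c finite_subset[OF supp finite_B]
      by (auto simp: coordinates_def C_def[of "_ :: 'a mpoly"])
    moreover have "C 1 = c 0" using C[of 0] card_R_pos by simp
    ultimately show ?thesis using c(3) by auto
  qed
  have unique: "C = C'" if C: "coordinates ?D B f C" and C': "coordinates ?D B f C'" for f C C'
  proof
    fix b
    have eq: "(\<Sum>m<card R. C (h ^ m) * h ^ m) = (\<Sum>m<card R. C' (h ^ m) * h ^ m)"
      using C C' sum_B[of C] sum_B[of C'] by (simp add: coordinates_def)
    show "C b = C' b"
    proof (cases "b \<in> B")
      case True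
      then obtain m where "b = h ^ m" "m < card R" by (auto simp: B')
      then show ?thesis
        using expansion_unique[OF _ _ eq] C C' by (simp add: coordinates_def)
    next
      case False
      then have "C b = 0" "C' b = 0" using C C' unfolding coordinates_def by blast+
      then show ?thesis by simp
    qed
  qed
  show "free_basis ?D B (invariants n P)"
    unfolding free_basis_def
  proof (intro conjI ballI)
    show "B \<subseteq> invariants n P" using h_invariant by (auto simp: B' intro: invariants_power)
    show "\<exists>!C. coordinates ?D B f C" if "f \<in> invariants n P" for f
      using ex[OF that] unique by blast
  qed
  show "natural_epi ?D B f = transfer R f" if f: "f \<in> invariants n P"
  proof -
    obtain C where C: "coordinates ?D B f C" "C 1 = transfer R f" using ex[OF f] by blast
    have "(THE C. coordinates ?D B f C) = C" using C(1) unique by (intro the_equality) auto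
    then show ?thesis using C(2) by (simp add: natural_epi_def)
  qed
qed

end

text \<open>The \<open>Suc\<close> is the missing term \<open>p^0\<close> of the geometric series,
  which corresponds to the exponent 0 in the basis.\<close>

lemma geometric_sum_nat:
  fixes p :: nat
  assumes "0 < p" "0 < n" shows "Suc (\<Sum>i = 1..n - 1. p ^ i) * (p - 1) = p ^ n - 1"
proof -
  have "(\<Sum>i<n. p ^ i) * (p - 1) = p ^ n - 1"
    using assms(1) by (induction n) (auto simp: algebra_simps)
  moreover have "(\<Sum>i<n. p ^ i) = Suc (\<Sum>i = 1..n - 1. p ^ i)"
    using assms(2) by (cases n) (simp_all add: lessThan_Suc_atMost atMost_atLeast0 sum.atLeast_Suc_atMost)
  ultimately show ?thesis by simp
qed

theorem proposition36:
  fixes p n :: nat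
    and B :: "'p::prime_card mod_ring mpoly set"
    and R :: "'p mod_ring mat set"
  assumes "p = CARD('p)" and "prime p" and "odd p" and "n \<ge> 2"
    and "B = {var 0 ^ ((p - 1) * m) | m. m \<le> (\<Sum>i = 1..n - 1. p ^ i)}"
    and "left_transversal R (GL n) (parabolic 1 (n - 1))"
  shows "free_basis (dickson_algebra n) B (invariants n (parabolic 1 (n - 1)))
       \<and> (\<forall>f \<in> invariants n (parabolic 1 (n - 1)).
            natural_epi (dickson_algebra n) B f = transfer R f)"
proof -
  interpret parabolic_transversal n R
    using assms by unfold_locales auto
  have p: "CARD('p mod_ring) = p" "1 < p"
    using assms(1) prime_gt_1_nat[OF assms(2)] by auto
  \<comment> \<open>The number of lines equals the number of exponents in \<open>B\<close>, so
    \<open>B\<close> consists of the powers of \<open>h\<close> below \<open>card R\<close>.\<close>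
  have "card R * (p - 1) = Suc (\<Sum>i = 1..n - 1. p ^ i) * (p - 1)"
    using card_R geometric_sum_nat[of p n] p n_pos by simp
  then have "card R = Suc (\<Sum>i = 1..n - 1. p ^ i)"
    using p(2) by (subst (asm) mult_right_cancel) auto
  then have "B = {(var 0 ^ (CARD('p mod_ring) - 1)) ^ m | m. m < card R}"
    unfolding assms(5) p(1) power_mult[symmetric] by (simp add: less_Suc_eq_le)
  from free_basis_h[OF this] natural_epi_eq_transfer[OF this] show ?thesis by blast
qed

end
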